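(* Let $n\ge2$, let $D\Subset\left(-\frac12,\frac12\right)^n$ be an open connected set with $C^1$ boundary containing $0$ such that $\Omega=\mathbb{R}^n\setminus\bigcup_{m\in\mathbb{Z}^n}(m+\overline D)$ is connected. Let $$H(y,p)=\frac{|p|^2}{2}+V(y)\qquad\text{for }(y,p)\in\mathbb{R}^n\times\mathbb{R}^n,$$ where $V\in C(\mathbb{R}^n)$ is $\mathbb{Z}^n$-periodic, $V=0$ on $\overline\Omega$ and $V>0$ in $\mathbb{R}^n\setminus\overline\Omega$. Let $I=\{0\}$ (only the hole at the origin is missing), so that $$W=\mathbb{R}^n\setminus\bigcup_{m\in\mathbb{Z}^n\setminus\{0\}}(m+\overline D),\qquad W_\varepsilon=\varepsilon W .$$ Let $g=0$. For $\varepsilon>0$ let $w^\varepsilon$ be the unique viscosity solution of the state-constraint problem $$w^\varepsilon_t+H\left(\tfrac x\varepsilon,Dw^\varepsilon\right)\le0\ \text{ in }W_\varepsilon\times(0,\infty),\quad w^\varepsilon_t+H\left(\tfrac x\varepsilon,Dw^\varepsilon\right)\ge0\ \text{ on }\overline W_\varepsilon\times(0,\infty),\quad w^\varepsilon(\cdot,0)=g\ \text{ on }\overline W_\varepsilon,$$ and let $u$ be the unique viscosity solution of $u_t+\overline H(Du)=0$ in $\mathbb{R}^n\times(0,\infty)$, $u(\cdot,0)=g$, where $\overline H=\overline H_\Omega$ is the effective Hamiltonian of the state-constraint cell problem on $\overline\Omega$. Then $$\limsup_{\varepsilon\to0}w^\varepsilon(0,1)\le-V(0)<u(0,1)=0 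.$$
   Context: State-constraint viscosity solutions: $w^\varepsilon$, continuous on $\overline W_\varepsilon\times[0,\infty)$, is a viscosity subsolution in $W_\varepsilon\times(0,\infty)$ in the usual sense and a supersolution on $\overline W_\varepsilon\times(0,\infty)$, i.e. test functions touching from below relative to $\overline W_\varepsilon\times(0,\infty)$ satisfy the inequality $\ge0$. Equivalently, with $L(y,v)=\sup_p(p\cdot v-H(y,p))=\frac{|v|^2}{2}-V(y)$, $$w^\varepsilon(x,t)=\inf\left\{\int_0^tL\left(\tfrac{\xi(s)}\varepsilon,\dot\xi(s)\right)ds+g(\xi(0)):\ \xi\in\mathrm{AC}([0,t];\overline W_\varepsilon),\ \xi(t)=x\right\},$$ where $\mathrm{AC}(J;U)$ denotes absolutely continuous curves $J\to U$. Effective Hamiltonian: for $p\in\mathbb{R}^n$, $\overline H(p)$ is the unique constant for which $H(y,p+Dv)\le\overline H(p)$ in $\Omega$, $H(y,p+Dv)\ge\overline H(p)$ on $\overline\Omega$ (state-constraint viscosity sense) has a $\mathbb{Z}^n$-periodic solution $v$. *)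

theory Defs
  imports "HOL-Analysis.Analysis"
begin

section \<open>Sets with C1 boundary and perforated domains\<close>

definition C1_gradient :: "('a::euclidean_space \<Rightarrow> real) \<Rightarrow> ('a \<Rightarrow> 'a) \<Rightarrow> bool" where
  "C1_gradient f G \<longleftrightarrow> (\<forall>z. GDERIV f z :> G z) \<and> continuous_on UNIV G"

text \<open>Near every boundary point the set is, in suitable orthonormal coordinates, the strict
  epigraph of a C1 function. The last coordinate is \<open>y \<bullet> \<nu>\<close>, and the remaining
  coordinates are those of the orthogonal projection of \<open>y\<close> to the hyperplane
  \<open>\<nu>\<^sup>\<bottom>\<close>; only the values of \<open>\<gamma>\<close> on that hyperplane matter.\<close>

definition C1_boundary :: "'a::euclidean_space set \<Rightarrow> bool" where
  "C1_boundary D \<longleftrightarrow>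
     (\<forall>x\<in>frontier D. \<exists>r>0. \<exists>\<nu> \<gamma> G. norm \<nu> = 1 \<and> C1_gradient \<gamma> G \<and>
        D \<inter> ball x r = {y \<in> ball x r. \<gamma> (y - (y \<bullet> \<nu>) *\<^sub>R \<nu>) < y \<bullet> \<nu>})"

definition open_unit_cube :: "(real ^ 'n) set" where
  "open_unit_cube = {x. \<forall>i. -1/2 < x $ i \<and> x $ i < 1/2}"

definition int_lattice :: "(real ^ 'n) set" where
  "int_lattice = {m. \<forall>i. m $ i \<in> \<int>}"

text \<open>The set \<open>M\<close> collects the positions of the holes.\<close>

definition perforated :: "(real ^ 'n) set \<Rightarrow> (real ^ 'n) set \<Rightarrow> (real ^ 'n) set" where
  "perforated D M = UNIV - (\<Union>m\<in>M. (\<lambda>y. m + y) ` closure D)"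

definition lattice_periodic_on :: "(real ^ 'n) set \<Rightarrow> (real ^ 'n \<Rightarrow> real) \<Rightarrow> bool" where
  "lattice_periodic_on S f \<longleftrightarrow> (\<forall>m\<in>int_lattice. \<forall>y\<in>S. y + m \<in> S \<longrightarrow> f (y + m) = f y)"

section \<open>Viscosity solutions\<close>

text \<open>\<open>F z q\<close> is the value of the operator at the point \<open>z\<close> and gradient \<open>q\<close>. Touching is
  local and relative to \<open>S\<close>, so that for a set \<open>S\<close> containing boundary points the
  supersolution property is the state-constraint one.\<close>

definition viscosity_subsolution ::
    "('a::euclidean_space \<Rightarrow> 'a \<Rightarrow> real) \<Rightarrow> 'a set \<Rightarrow> ('a \<Rightarrow> real) \<Rightarrow> bool" where
  "viscosity_subsolution F S w \<longleftrightarrow>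
     (\<forall>\<phi> G. \<forall>z\<in>S. C1_gradient \<phi> G \<longrightarrow>
        (\<forall>\<^sub>F z' in at z within S. w z' - \<phi> z' \<le> w z - \<phi> z) \<longrightarrow> F z (G z) \<le> 0)"

definition viscosity_supersolution ::
    "('a::euclidean_space \<Rightarrow> 'a \<Rightarrow> real) \<Rightarrow> 'a set \<Rightarrow> ('a \<Rightarrow> real) \<Rightarrow> bool" where
  "viscosity_supersolution F S w \<longleftrightarrow>
     (\<forall>\<phi> G. \<forall>z\<in>S. C1_gradient \<phi> G \<longrightarrow>
        (\<forall>\<^sub>F z' in at z within S. w z' - \<phi> z' \<ge> w z - \<phi> z) \<longrightarrow> F z (G z) \<ge> 0)"

text \<open>The gradient of a test function on space-time is the pair of the spatial gradient and the
  time derivative.\<close>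

definition evolution_operator ::
    "(real ^ 'n \<Rightarrow> real ^ 'n \<Rightarrow> real) \<Rightarrow> (real ^ 'n) \<times> real \<Rightarrow> (real ^ 'n) \<times> real \<Rightarrow> real" where
  "evolution_operator H = (\<lambda>(x, t) (p, q). q + H x p)"

text \<open>Continuous solutions of the Cauchy problem with state constraint in the closure of the open
  set \<open>U\<close>. For \<open>U = UNIV\<close> this is the Cauchy problem on the whole space.\<close>

definition state_constraint_Cauchy_solution ::
    "(real ^ 'n \<Rightarrow> real ^ 'n \<Rightarrow> real) \<Rightarrow> (real ^ 'n) set \<Rightarrow> (real ^ 'n \<Rightarrow> real)
      \<Rightarrow> (real ^ 'n \<Rightarrow> real \<Rightarrow> real) \<Rightarrow> bool" where
  "state_constraint_Cauchy_solution H U g w \<longleftrightarrow>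
     continuous_on (closure U \<times> {0..}) (\<lambda>(x, t). w x t) \<and>
     viscosity_subsolution (evolution_operator H) (U \<times> {0<..}) (\<lambda>(x, t). w x t) \<and>
     viscosity_supersolution (evolution_operator H) (closure U \<times> {0<..}) (\<lambda>(x, t). w x t) \<and>
     (\<forall>x\<in>closure U. w x 0 = g x)"

definition cell_problem_solution ::
    "(real ^ 'n \<Rightarrow> real ^ 'n \<Rightarrow> real) \<Rightarrow> (real ^ 'n) set \<Rightarrow> real ^ 'n \<Rightarrow> real
      \<Rightarrow> (real ^ 'n \<Rightarrow> real) \<Rightarrow> bool" where
  "cell_problem_solution H U p c v \<longleftrightarrow>
     continuous_on (closure U) v \<and> lattice_periodic_on (closure U) v \<and>
     viscosity_subsolution (\<lambda>y q. H y (p + q) - c) U v \<and>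
     viscosity_supersolution (\<lambda>y q. H y (p + q) - c) (closure U) v"

text \<open>\<open>Hbar p\<close> is the unique constant for which the cell problem is solvable.\<close>

definition is_effective_Hamiltonian ::
    "(real ^ 'n \<Rightarrow> real ^ 'n \<Rightarrow> real) \<Rightarrow> (real ^ 'n) set \<Rightarrow> (real ^ 'n \<Rightarrow> real) \<Rightarrow> bool" where
  "is_effective_Hamiltonian H U Hbar \<longleftrightarrow>
     (\<forall>p. (\<exists>v. cell_problem_solution H U p (Hbar p) v) \<and>
          (\<forall>c. (\<exists>v. cell_problem_solution H U p c v) \<longrightarrow> c = Hbar p))"

definition mechanical_Hamiltonian ::
    "(real ^ 'n \<Rightarrow> real) \<Rightarrow> real ^ 'n \<Rightarrow> real ^ 'n \<Rightarrow> real" where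
  "mechanical_Hamiltonian V y p = (norm p)\<^sup>2 / 2 + V y"

end

theory Submission
  imports Defs
begin

text \<open>At the missing hole the constant curve is admissible and collects the potential \<open>V 0\<close>:
  along the time axis over the origin the subsolution property gives \<open>w\<^sub>t \<le> - V 0\<close>, up to an
  error that vanishes with the distance to the origin, whence \<open>w \<epsilon> 0 1 \<le> - V 0\<close> for every
  \<open>\<epsilon>\<close>.

  The statement \<open>u 0 1 = 0\<close> is a uniqueness result without any growth condition on \<open>u\<close>. As \<open>V\<close>
  vanishes on \<open>closure \<Omega>\<close>, the effective Hamiltonian is half the square of an asymmetric norm
  \<open>N \<le> norm\<close>: homogeneity comes from scaling correctors, subadditivity from comparing the
  corrector of a sum with the sum of two correctors, and definiteness from the connectedness of
  \<open>\<Omega>\<close>. Optimal curves of the homogenized problem are straight lines traversed at constant speed,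
  so a negative value of \<open>u\<close> caused by data coming from far away would force arbitrarily negative
  values in a fixed neighbourhood.\<close>

section \<open>Viscosity subsolutions along segments\<close>

text \<open>The effective Hamiltonian is given only through existence and uniqueness of its cell
  constants, so each of its properties has to be extracted from correctors. Subsolutions are
  exploited along segments, supersolutions through explicit test functions. The obstacle is
  regularity: half the square of \<open>N\<close> need not be strictly convex, so its conjugate may
  fail to be C1 and cannot enter a test function. Adding a small multiple of
  \<open>(norm p)\<^sup>2\<close> to \<open>Hbar\<close> makes the conjugate \<open>L\<close> C1. As
  definiteness bounds \<open>Hbar\<close> from below by a multiple of
  \<open>(norm p)\<^sup>2\<close>, the price is a factor \<kappa> > 1, arbitrarily close to 1. It is
  absorbed because the line towards \<open>(x0, T)\<close> is left when the fraction \<theta> of it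
  remains: \<open>(1 - \<theta>) * (1 + \<theta> / 2) \<le> 1 - \<theta> / 2\<close> saves the
  fraction \<theta> / 2 of a quantity that grows like the square of the radius, and \<theta> is the
  reciprocal of the radius.\<close>

text \<open>Touching relative to a smaller set is a weaker demand, so subsolutions do not restrict
  to arbitrary subsets; at points of an open \<open>T\<close> both demands concern a full
  neighbourhood. Changing the operator at the same time replaces a nonlinear inequality by a linear
  one, \<open>p \<bullet> q - l\<close>.\<close>

lemma viscosity_subsolution_mono:
  assumes "viscosity_subsolution F S w" and "open T" and "T \<subseteq> S"
    and "\<And>z p. z \<in> T \<Longrightarrow> F z p \<le> 0 \<Longrightarrow> F' z p \<le> 0"
  shows "viscosity_subsolution F' T w"
  unfolding viscosity_subsolution_def
proof (intro allI ballI impI)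
  fix \<phi> G z
  assume z: "z \<in> T" and \<phi>: "C1_gradient \<phi> G"
    and ev: "\<forall>\<^sub>F z' in at z within T. w z' - \<phi> z' \<le> w z - \<phi> z"
  have "\<forall>\<^sub>F z' in at z. w z' - \<phi> z' \<le> w z - \<phi> z"
    using ev at_within_open[OF z \<open>open T\<close>] by simp
  then have "\<forall>\<^sub>F z' in at z within S. w z' - \<phi> z' \<le> w z - \<phi> z"
    using filter_leD[OF at_le[OF subset_UNIV]] by blast
  then have "F z (G z) \<le> 0"
    using assms(1,3) z \<phi> unfolding viscosity_subsolution_def by blast
  then show "F' z (G z) \<le> 0" using assms(4) z by blast
qed

text \<open>The test function \<open>l \<tau> + A \<tau>\<^sup>m + C |\<pi>|\<^sup>2\<close> has slope larger than \<open>l\<close> in direction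
  \<open>q\<close>; its steep end \<open>A \<tau>\<^sup>m\<close> keeps the maximum of the difference away from the
  endpoint \<open>\<tau> = 1\<close>, and the penalty \<open>C |\<pi>|\<^sup>2\<close> keeps it near the segment.\<close>

lemma viscosity_subsolution_along_segment:
  fixes w :: "'a::euclidean_space \<Rightarrow> real"
  assumes "open S" and cont: "continuous_on S w"
    and sub: "viscosity_subsolution (\<lambda>z p. p \<bullet> q - l) S w"
    and seg: "closed_segment a (a + q) \<subseteq> S" and "q \<noteq> 0"
  shows "w (a + q) \<le> w a + l"
proof (rule ccontr)
  assume neg: "\<not> w (a + q) \<le> w a + l"
  define k1 where "k1 = w (a + q) - w a - l"
  have k1: "k1 > 0" using neg by (simp add: k1_def)
  define \<tau> where "\<tau> z = ((z - a) \<bullet> q) / (q \<bullet> q)" for z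
  define \<pi> where "\<pi> z = z - a - \<tau> z *\<^sub>R q" for z
  have qq: "q \<bullet> q > 0" using \<open>q \<noteq> 0\<close> by simp
  have contw: "isCont w z" if "z \<in> S" for z
    using cont that \<open>open S\<close> by (simp add: continuous_on_eq_continuous_at)
  have in_seg: "a + t *\<^sub>R q \<in> closed_segment a (a + q)" if "0 \<le> t" "t \<le> 1" for t
    unfolding in_segment using that by (intro exI[of _ t]) (simp add: algebra_simps)
  have aS: "a \<in> S" "a + q \<in> S" using seg by auto
  obtain r0 where r0: "r0 > 0" "(\<Union>x\<in>closed_segment a (a + q). cball x r0) \<subseteq> S"
    using compact_subset_open_imp_cball_epsilon_subset[OF compact_segment \<open>open S\<close> seg] by blast
  have "\<forall>\<^sub>F z in nhds a. w z < w a + k1 / 8"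
    using contw[OF aS(1)] k1
    by (intro order_tendstoD) (auto simp: continuous_at tendsto_nhds_iff)
  then obtain r1 where r1: "r1 > 0" "\<And>z. dist z a < r1 \<Longrightarrow> w z < w a + k1 / 8"
    unfolding eventually_nhds_metric by blast
  \<comment> \<open>At least half of the excess \<open>k1\<close> survives at some
    \<open>t < 1\<close>. There \<open>A * t ^ Suc m\<close> drops below \<open>k1 / 4\<close> for
    large \<open>m\<close>, whereas at 1 the steep term keeps the value \<open>A\<close>.\<close>
  have "((\<lambda>t. w (a + t *\<^sub>R q) - w a - l * t) \<longlongrightarrow> w (a + 1 *\<^sub>R q) - w a - l * 1) (at_left 1)"
    using contw[OF aS(2)]
    by (intro tendsto_intros isCont_tendsto_compose[where g = w]) auto
  then have "\<forall>\<^sub>F t in at_left 1. w (a + t *\<^sub>R q) - w a - l * t > k1 / 2"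
    using k1 by (intro order_tendstoD(1)) (auto simp: k1_def)
  moreover have "\<forall>\<^sub>F t in at_left (1::real). 0 < t \<and> t < 1"
    using eventually_at_left[of 0 "1::real"] by (auto intro!: exI[of _ 0])
  ultimately have "\<forall>\<^sub>F t in at_left (1::real). w (a + t *\<^sub>R q) - w a - l * t > k1 / 2 \<and> 0 < t \<and> t < 1"
    by eventually_elim auto
  then obtain t where t: "w (a + t *\<^sub>R q) - w a - l * t > k1 / 2" "0 < t" "t < 1"
    using eventually_happens trivial_limit_at_left_real by blast
  define r where "r = min r0 (r1 / 2)"
  have r: "0 < r" "r \<le> r0" "r < r1" using r0 r1 by (auto simp: r_def)
  define K where "K = {z. 0 \<le> \<tau> z \<and> \<tau> z \<le> 1 \<and> norm (\<pi> z) \<le> r}"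
  have decomp: "z = (a + \<tau> z *\<^sub>R q) + \<pi> z" for z by (simp add: \<pi>_def)
  have KS: "K \<subseteq> S"
  proof
    fix z assume "z \<in> K"
    then have "a + \<tau> z *\<^sub>R q \<in> closed_segment a (a + q)" and "norm (\<pi> z) \<le> r0"
      using in_seg r by (auto simp: K_def)
    moreover have "z \<in> cball (a + \<tau> z *\<^sub>R q) r0"
      using \<open>norm (\<pi> z) \<le> r0\<close> by (simp add: dist_norm \<pi>_def norm_minus_commute algebra_simps)
    ultimately show "z \<in> S" using r0(2) by blast
  qed
  have cont\<tau>: "continuous_on X \<tau>" for X unfolding \<tau>_def using qq by (intro continuous_intros) auto
  have cont\<pi>: "continuous_on X \<pi>" for X unfolding \<pi>_def by (intro continuous_intros cont\<tau>)
  have "closed K" unfolding K_def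
    by (intro closed_Collect_conj closed_Collect_le continuous_intros cont\<tau> cont\<pi>)
  moreover have "bounded K"
  proof -
    have "norm (z - a) \<le> norm q + r" if "z \<in> K" for z
    proof -
      have "z - a = \<tau> z *\<^sub>R q + \<pi> z" by (simp add: \<pi>_def)
      then have "norm (z - a) \<le> \<bar>\<tau> z\<bar> * norm q + norm (\<pi> z)"
        by (metis norm_scaleR norm_triangle_ineq)
      also have "\<dots> \<le> 1 * norm q + r"
        using that by (intro add_mono mult_right_mono) (auto simp: K_def)
      finally show ?thesis by simp
    qed
    then have "K \<subseteq> cball a (norm q + r)" by (auto simp: dist_norm norm_minus_commute)
    then show ?thesis using bounded_cball bounded_subset by blast
  qed
  ultimately have "compact K" by (simp add: compact_eq_bounded_closed)
  define k where "k z = w z - w a - l * \<tau> z" for z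
  have contk: "continuous_on K k" unfolding k_def
    by (intro continuous_intros cont\<tau> continuous_on_subset[OF cont KS])
  obtain B where B: "\<And>z. z \<in> K \<Longrightarrow> \<bar>k z\<bar> \<le> B"
    using compact_imp_bounded[OF compact_continuous_image[OF contk \<open>compact K\<close>]]
    unfolding bounded_iff by auto
  \<comment> \<open>A penalty above the bound \<open>B\<close> for \<open>k\<close> makes
    \<open>f\<close> negative: \<open>A\<close> does so on the face \<tau> = 1, \<open>C\<close> on
    the lateral face \<open>norm (\<pi> z) = r\<close>.\<close>
  define A where "A = \<bar>B\<bar> + 1"
  define C where "C = (\<bar>B\<bar> + 1) / r\<^sup>2"
  have AC: "A > 0" "C > 0" "B < A" "B < C * r\<^sup>2"
    using r by (auto simp: A_def C_def)
  have "(\<lambda>m. A * t ^ m) \<longlonglongrightarrow> A * 0"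
    using t by (intro tendsto_intros LIMSEQ_realpow_zero) auto
  then have "\<forall>\<^sub>F m in sequentially. A * t ^ m < k1 / 4"
    using k1 by (intro order_tendstoD) auto
  then obtain m where "A * t ^ Suc m < k1 / 4"
    unfolding eventually_sequentially by (meson le_SucI order_refl)
  define f where "f z = k z - A * \<tau> z ^ Suc m - C * (\<pi> z \<bullet> \<pi> z)" for z
  define b where "b = a + t *\<^sub>R q"
  have "\<tau> b = t" using qq by (simp add: \<tau>_def b_def)
  then have "\<pi> b = 0" by (simp add: \<pi>_def b_def)
  have "b \<in> K" using t r \<open>\<tau> b = t\<close> \<open>\<pi> b = 0\<close> by (simp add: K_def)
  have fb: "f b > k1 / 4"
    using t(1) \<open>A * t ^ Suc m < k1 / 4\<close> 
    by (simp add: f_def k_def \<open>\<tau> b = t\<close> \<open>\<pi> b = 0\<close> flip: b_def)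
  have "continuous_on K f" unfolding f_def
    by (intro continuous_intros contk cont\<tau> cont\<pi>)
  then obtain z where z: "z \<in> K" and zmax: "\<And>y. y \<in> K \<Longrightarrow> f y \<le> f z"
    using continuous_attains_sup[OF \<open>compact K\<close>] \<open>b \<in> K\<close> by blast
  have fz: "f z > k1 / 4" using zmax[OF \<open>b \<in> K\<close>] fb by simp
  have \<tau>z: "0 \<le> \<tau> z" "\<tau> z \<le> 1" "norm (\<pi> z) \<le> r" using z by (auto simp: K_def)
  have kz: "k z \<le> B" using B[OF z] by simp
  have pen: "0 \<le> A * \<tau> z ^ Suc m" "0 \<le> C * (\<pi> z \<bullet> \<pi> z)" using AC \<tau>z by auto
  have "\<tau> z \<noteq> 0"
  proof
    assume "\<tau> z = 0"
    then have "dist z a \<le> r" using \<tau>z by (simp add: \<pi>_def dist_norm)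
    then have "k z < k1 / 8" using r1(2)[of z] r \<open>\<tau> z = 0\<close> by (simp add: k_def)
    then show False using fz pen k1 by (simp add: f_def)
  qed
  moreover have "\<tau> z \<noteq> 1"
  proof
    assume "\<tau> z = 1"
    then show False using fz pen kz AC k1 by (simp add: f_def)
  qed
  moreover have "norm (\<pi> z) \<noteq> r"
  proof
    assume "norm (\<pi> z) = r"
    then have "C * (\<pi> z \<bullet> \<pi> z) = C * r\<^sup>2" by (simp add: power2_norm_eq_inner[symmetric])
    then show False using fz pen(1) kz AC k1 by (simp add: f_def)
  qed
  ultimately have int: "0 < \<tau> z" "\<tau> z < 1" "norm (\<pi> z) < r" using \<tau>z by auto
  have "open {y. 0 < \<tau> y \<and> \<tau> y < 1 \<and> norm (\<pi> y) < r}"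
    by (intro open_Collect_conj open_Collect_less continuous_intros cont\<tau> cont\<pi>)
  then have "\<forall>\<^sub>F y in nhds z. 0 < \<tau> y \<and> \<tau> y < 1 \<and> norm (\<pi> y) < r"
    using int eventually_nhds by (metis (mono_tags, lifting) mem_Collect_eq)
  then have "\<forall>\<^sub>F y in nhds z. f y \<le> f z"
    by eventually_elim (auto intro!: zmax simp: K_def)
  define \<phi> where "\<phi> y = l * \<tau> y + A * \<tau> y ^ Suc m
      + C * ((y - a) \<bullet> (y - a) - (\<tau> y)\<^sup>2 * (q \<bullet> q))" for y
  define G where "G y = (l / (q \<bullet> q)) *\<^sub>R q + (A * (1 + real m) * \<tau> y ^ m / (q \<bullet> q)) *\<^sub>R q
      + C *\<^sub>R (2 *\<^sub>R (y - a) - (2 * \<tau> y) *\<^sub>R q)" for y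
  have \<pi>2: "\<pi> y \<bullet> \<pi> y = (y - a) \<bullet> (y - a) - (\<tau> y)\<^sup>2 * (q \<bullet> q)" for y
  proof -
    have e: "(y - a) \<bullet> q = \<tau> y * (q \<bullet> q)" using qq by (simp add: \<tau>_def)
    have "\<pi> y \<bullet> \<pi> y = (y - a) \<bullet> (y - a) - 2 * \<tau> y * ((y - a) \<bullet> q) + (\<tau> y)\<^sup>2 * (q \<bullet> q)"
      unfolding \<pi>_def by (simp add: inner_simps inner_commute power2_eq_square algebra_simps)
    then show ?thesis by (simp add: e power2_eq_square)
  qed
  have d\<tau>: "(\<tau> has_derivative (\<lambda>h. (h \<bullet> q) / (q \<bullet> q))) (at y)" for y
    unfolding \<tau>_def using qq by (auto intro!: derivative_eq_intros)
  have "C1_gradient \<phi> G"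
    unfolding C1_gradient_def
  proof
    show "\<forall>y. GDERIV \<phi> y :> G y"
      unfolding gderiv_def \<phi>_def G_def
      by (auto intro!: derivative_eq_intros d\<tau> ext
          simp: inner_simps inner_commute algebra_simps)
        (cases m; simp add: add_divide_distrib algebra_simps)
    show "continuous_on UNIV G" unfolding G_def using qq by (intro continuous_intros cont\<tau>) auto
  qed
  moreover have "\<forall>\<^sub>F y in at z within S. w y - \<phi> y \<le> w z - \<phi> z"
    using \<open>\<forall>\<^sub>F y in nhds z. f y \<le> f z\<close>
    unfolding eventually_at_filter
    by eventually_elim (simp add: f_def k_def \<phi>_def \<pi>2)
  ultimately have "G z \<bullet> q - l \<le> 0"
    using sub z KS unfolding viscosity_subsolution_def by blast
  \<comment> \<open>The penalty has gradient \<open>(2 * C) *\<^sub>R \<pi> z\<close>, which is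
    orthogonal to \<open>q\<close>; only \<open>l\<close> and the steep term remain.\<close>
  moreover have "G z \<bullet> q = l + A * (1 + real m) * \<tau> z ^ m"
    using qq unfolding G_def by (simp add: inner_simps \<tau>_def inner_commute)
  moreover have "A * (1 + real m) * \<tau> z ^ m > 0" using AC int by simp
  ultimately show False by linarith
qed

section \<open>A smooth Legendre transform\<close>

text \<open>Maximality of \<open>p\<close> is tested at the midpoint of \<open>p\<close> and
  \<open>p'\<close>; the convexity gain \<eta> / 8 there becomes \<eta> / 4 after doubling.\<close>

lemma midpoint_strongly_convex_maximizer:
  fixes K :: "'a::real_inner \<Rightarrow> real"
  assumes mid: "K ((1/2) *\<^sub>R (p + p')) \<le> (K p + K p') / 2 - \<eta> / 8 * (norm (p - p'))\<^sup>2"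
    and max: "\<And>r. r \<bullet> q - K r \<le> p \<bullet> q - K p"
  shows "p' \<bullet> q - K p' \<le> p \<bullet> q - K p - \<eta> / 4 * (norm (p - p'))\<^sup>2"
  using max[of "(1/2) *\<^sub>R (p + p')"] mid by (simp add: inner_simps field_simps)

text \<open>First-order condition at \<open>t = 1\<close>, from dividing by \<open>t - 1\<close> on
  either side. At a maximizer of a pairing minus a 2-homogeneous function it becomes Euler's
  relation.\<close>

lemma euler_homogeneous_maximum:
  fixes A B :: real
  assumes "\<And>t. t > 0 \<Longrightarrow> t * A - t\<^sup>2 * B \<le> A - B"
  shows "A = 2 * B"
proof -
  have *: "s * (A - 2 * B) \<le> s\<^sup>2 * B" if "s > - 1" for s
    using assms[of "1 + s"] that by (simp add: power2_eq_square algebra_simps)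
  have lim: "((\<lambda>s. s * B) \<longlongrightarrow> 0 * B) (at_right 0)" "((\<lambda>s. s * B) \<longlongrightarrow> 0 * B) (at_left 0)"
    by (intro tendsto_intros)+
  have ev: "\<forall>\<^sub>F s in at_right 0. A - 2 * B \<le> s * B"
    unfolding eventually_at_right_field
  proof (intro exI[of _ 1] conjI allI impI)
    fix s :: real assume "0 < s" "s < 1"
    then have "s * (A - 2 * B) \<le> s * (s * B)" using *[of s] by (simp add: power2_eq_square)
    then show "A - 2 * B \<le> s * B" using \<open>0 < s\<close> by simp
  qed simp
  have ev': "\<forall>\<^sub>F s in at_left 0. s * B \<le> A - 2 * B"
    unfolding eventually_at_left_field
  proof (intro exI[of _ "-1"] conjI allI impI)
    fix s :: real assume "-1 < s" "s < 0"
    then have "s * (A - 2 * B) \<le> s * (s * B)" using *[of s] by (simp add: power2_eq_square)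
    then show "s * B \<le> A - 2 * B" using \<open>s < 0\<close> by simp
  qed simp
  show ?thesis
    using tendsto_lowerbound[OF lim(1) ev] tendsto_upperbound[OF lim(2) ev'] by simp
qed

text \<open>Strong convexity makes the maximizer \<open>P q\<close> Lipschitz in \<open>q\<close>,
  so by the envelope argument it is the gradient of the conjugate \<open>L\<close>. Through Euler's
  relation, \<open>K (P q) = L q\<close> says that \<open>L x / t\<close> is a classical solution of
  the evolution equation for \<open>K\<close>.\<close>

lemma smooth_conjugate:
  fixes K :: "'a::euclidean_space \<Rightarrow> real"
  assumes cont: "continuous_on UNIV K" and "\<eta> > 0"
    and hom: "\<And>t p. t \<ge> 0 \<Longrightarrow> K (t *\<^sub>R p) = t\<^sup>2 * K p"
    and coercive: "\<And>p. \<eta> / 2 * (norm p)\<^sup>2 \<le> K p"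
    and mid: "\<And>p p'. K ((1/2) *\<^sub>R (p + p')) \<le> (K p + K p') / 2 - \<eta> / 8 * (norm (p - p'))\<^sup>2"
  obtains L P where "C1_gradient L P" and "\<And>p q. p \<bullet> q - K p \<le> L q"
    and "\<And>q. K (P q) = L q" and "\<And>t q. t > 0 \<Longrightarrow> L (t *\<^sub>R q) = t\<^sup>2 * L q"
proof -
  have K0: "K 0 = 0" using hom[of 0 0] by simp
  have "\<exists>p. \<forall>r. r \<bullet> q - K r \<le> p \<bullet> q - K p" for q
  proof -
    \<comment> \<open>Outside this ball coercivity gives \<open>r \<bullet> q \<le> K r\<close>, so
      the competitor 0 does at least as well.\<close>
    define R where "R = 2 * norm q / \<eta>"
    have "R \<ge> 0" using \<open>\<eta> > 0\<close> by (simp add: R_def)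
    have "continuous_on (cball (0::'a) R) (\<lambda>p. p \<bullet> q - K p)"
      by (intro continuous_intros continuous_on_subset[OF cont]) auto
    moreover have "(0::'a) \<in> cball 0 R" using \<open>R \<ge> 0\<close> by simp
    ultimately obtain p where p: "\<And>r. r \<in> cball 0 R \<Longrightarrow> r \<bullet> q - K r \<le> p \<bullet> q - K p"
      using continuous_attains_sup[OF compact_cball, of 0 R] by blast
    have "r \<bullet> q - K r \<le> p \<bullet> q - K p" for r
    proof (cases "r \<in> cball 0 R")
      case False
      then have "norm r \<ge> R" by simp
      then have "\<eta> / 2 * R \<le> \<eta> / 2 * norm r" using \<open>\<eta> > 0\<close> by (intro mult_left_mono) auto
      then have "norm q \<le> \<eta> / 2 * norm r" using \<open>\<eta> > 0\<close> by (simp add: R_def)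
      then have "norm q * norm r \<le> \<eta> / 2 * norm r * norm r" by (rule mult_right_mono) simp
      then have "r \<bullet> q \<le> K r"
        using norm_cauchy_schwarz[of r q] coercive[of r] by (simp add: power2_eq_square algebra_simps)
      then show ?thesis using p[OF \<open>0 \<in> cball 0 R\<close>] K0 by simp
    qed (rule p)
    then show ?thesis by blast
  qed
  then obtain P where P: "\<And>q r. r \<bullet> q - K r \<le> P q \<bullet> q - K (P q)" by metis
  define L where "L q = P q \<bullet> q - K (P q)" for q
  have fenchel: "p \<bullet> q - K p \<le> L q" for p q using P by (simp add: L_def)
  have lip: "norm (P q - P q') \<le> 2 / \<eta> * norm (q - q')" for q q'
  proof -
    have "P q' \<bullet> q - K (P q') \<le> P q \<bullet> q - K (P q) - \<eta> / 4 * (norm (P q - P q'))\<^sup>2"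
      by (rule midpoint_strongly_convex_maximizer[OF mid P])
    moreover have "P q \<bullet> q' - K (P q) \<le> P q' \<bullet> q' - K (P q') - \<eta> / 4 * (norm (P q' - P q))\<^sup>2"
      by (rule midpoint_strongly_convex_maximizer[OF mid P])
    ultimately have "\<eta> / 2 * (norm (P q - P q'))\<^sup>2 \<le> (P q - P q') \<bullet> (q - q')"
      by (simp add: inner_simps norm_minus_commute)
    also have "\<dots> \<le> norm (P q - P q') * norm (q - q')" by (rule norm_cauchy_schwarz)
    finally have "norm (P q - P q') * (\<eta> / 2 * norm (P q - P q')) \<le> norm (P q - P q') * norm (q - q')"
      by (simp add: power2_eq_square algebra_simps)
    then have "P q \<noteq> P q' \<Longrightarrow> \<eta> / 2 * norm (P q - P q') \<le> norm (q - q')" by simp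
    then show ?thesis using \<open>\<eta> > 0\<close> by (cases "P q = P q'") (simp_all add: field_simps)
  qed
  have contP: "continuous_on UNIV P"
  proof (rule lipschitz_on_continuous_on)
    show "(2 / \<eta>)-lipschitz_on UNIV P"
      by (rule lipschitz_onI) (use lip \<open>\<eta> > 0\<close> in \<open>auto simp: dist_norm\<close>)
  qed
  \<comment> \<open>Fenchel's inequality at \<open>q\<close> and at \<open>q'\<close> squeezes the
    remainder between 0 and \<open>(P q' - P q) \<bullet> (q' - q)\<close>, which is quadratic by
    the Lipschitz bound.\<close>
  have sandwich: "norm (L q' - L q - (q' - q) \<bullet> P q) \<le> 2 / \<eta> * norm (q' - q) * norm (q' - q)" for q q'
  proof -
    have "P q \<bullet> q' - K (P q) \<le> L q'" "P q' \<bullet> q - K (P q') \<le> L q" by (rule fenchel)+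
    then have lo: "0 \<le> L q' - L q - (q' - q) \<bullet> P q"
      and "L q' - L q - (q' - q) \<bullet> P q \<le> (P q' - P q) \<bullet> (q' - q)"
      by (simp_all add: L_def inner_simps inner_commute)
    note this(2)
    also have "(P q' - P q) \<bullet> (q' - q) \<le> norm (P q' - P q) * norm (q' - q)"
      by (rule norm_cauchy_schwarz)
    also have "\<dots> \<le> (2 / \<eta> * norm (q' - q)) * norm (q' - q)"
      by (intro mult_right_mono lip) simp
    finally show ?thesis using lo by simp
  qed
  have deriv: "GDERIV L q :> P q" for q
    unfolding gderiv_def has_derivative_at_within
  proof (intro conjI bounded_linear_inner_left)
    have "((\<lambda>y. 2 / \<eta> * norm (y - q)) \<longlongrightarrow> 2 / \<eta> * norm (q - q)) (at q)"
      by (intro tendsto_intros)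
    then have lim: "((\<lambda>y. 2 / \<eta> * norm (y - q)) \<longlongrightarrow> 0) (at q)" by simp
    show "((\<lambda>y. ((L y - L q) - (y - q) \<bullet> P q) /\<^sub>R norm (y - q)) \<longlongrightarrow> 0) (at q)"
    proof (rule Lim_null_comparison[OF _ lim])
      show "\<forall>\<^sub>F y in at q. norm (((L y - L q) - (y - q) \<bullet> P q) /\<^sub>R norm (y - q))
          \<le> 2 / \<eta> * norm (y - q)"
        unfolding eventually_at_filter
      proof (intro always_eventually allI impI)
        fix y assume "y \<noteq> q"
        then show "norm (((L y - L q) - (y - q) \<bullet> P q) /\<^sub>R norm (y - q))
          \<le> 2 / \<eta> * norm (y - q)"
          using sandwich[of y q] by (simp add: divide_le_eq diff_diff_eq divide_inverse_commute[symmetric])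
      qed
    qed
  qed
  have euler: "K (P q) = L q" for q
  proof -
    have "P q \<bullet> q = 2 * K (P q)"
    proof (rule euler_homogeneous_maximum)
      fix t :: real assume "t > 0"
      then show "t * (P q \<bullet> q) - t\<^sup>2 * K (P q) \<le> P q \<bullet> q - K (P q)"
        using P[of "t *\<^sub>R P q" q] by (simp add: hom)
    qed
    then show ?thesis by (simp add: L_def)
  qed
  have homL_le: "L (t *\<^sub>R q) \<le> t\<^sup>2 * L q" if "t > 0" for t q
  proof -
    define r where "r = (1 / t) *\<^sub>R P (t *\<^sub>R q)"
    have r: "P (t *\<^sub>R q) = t *\<^sub>R r" using that by (simp add: r_def)
    have "L (t *\<^sub>R q) = t\<^sup>2 * (r \<bullet> q - K r)"
      unfolding L_def r using that by (simp add: hom power2_eq_square algebra_simps)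
    also have "\<dots> \<le> t\<^sup>2 * L q" by (intro mult_left_mono fenchel) simp
    finally show ?thesis .
  qed
  have homL: "L (t *\<^sub>R q) = t\<^sup>2 * L q" if "t > 0" for t q
  proof (rule antisym[OF homL_le[OF that]])
    have "L q \<le> (1 / t)\<^sup>2 * L (t *\<^sub>R q)" using homL_le[of "1 / t" "t *\<^sub>R q"] that by simp
    then show "t\<^sup>2 * L q \<le> L (t *\<^sub>R q)" using that by (simp add: field_simps)
  qed
  show thesis
    by (rule that[OF _ fenchel euler homL])
      (use deriv contP in \<open>auto simp: C1_gradient_def\<close>)
qed

section \<open>The homogeneous Cauchy problem with zero data\<close>

text \<open>Test functions are C1 on all of space-time, whereas \<open>1 / (T - s)\<close> has a
  pole. The quadratic agrees with it to first order at \<open>s0\<close>; doubling the second Taylor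
  coefficient \<open>1 / (T - s0) ^ 3\<close> keeps it above while at least half of the distance to
  the pole remains.\<close>

lemma quadratic_above_reciprocal:
  fixes T s s0 :: real
  assumes "s0 < T" and "s \<le> (s0 + T) / 2"
  shows "1 / (T - s) \<le> 1 / (T - s0) + (s - s0) / (T - s0)\<^sup>2 + 2 / (T - s0) ^ 3 * (s - s0)\<^sup>2"
proof -
  define a where "a = T - s0"
  define x where "x = s - s0"
  have a: "a > 0" and x: "x \<le> a / 2" using assms by (auto simp: a_def x_def field_simps)
  then have ax: "a - x > 0" by simp
  define i where "i = 1 / a"
  have i: "i > 0" "a * i = 1" using a by (simp_all add: i_def)
  have "(i + x * i\<^sup>2 + 2 * i ^ 3 * x\<^sup>2) * (a - x) = 1 + i ^ 3 * x\<^sup>2 * (a - 2 * x)"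
    using i(2) by algebra
  moreover have "0 \<le> i ^ 3 * x\<^sup>2 * (a - 2 * x)" using i x by simp
  ultimately have "1 / (a - x) \<le> i + x * i\<^sup>2 + 2 * i ^ 3 * x\<^sup>2"
    using ax by (simp add: divide_le_eq)
  then have "1 / (a - x) \<le> 1 / a + x / a\<^sup>2 + 2 / a ^ 3 * x\<^sup>2"
    by (simp add: i_def power_divide)
  then show ?thesis by (simp add: a_def x_def)
qed

text \<open>The number \<open>l\<close> dominates \<open>t - s\<close> times the conjugate of
  \<open>H\<close> at the mean velocity, so this is one half of the Hopf-Lax formula: the slope of a
  subsolution along the space-time segment is at most \<open>l\<close>.\<close>

lemma evolution_subsolution_increment:
  fixes u :: "real ^ 'n \<Rightarrow> real \<Rightarrow> real"
  assumes cont: "continuous_on (UNIV \<times> {0..}) (\<lambda>(x, t). u x t)"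
    and sub: "viscosity_subsolution (evolution_operator (\<lambda>x p. H p)) (UNIV \<times> {0<..}) (\<lambda>(x, t). u x t)"
    and fenchel: "\<And>p. p \<bullet> (y - x) - (t - s) * H p \<le> l"
    and "0 < s" "s < t"
  shows "u y t \<le> u x s + l"
proof -
  have "viscosity_subsolution (\<lambda>z p. p \<bullet> (y - x, t - s) - l) (UNIV \<times> {0<..}) (\<lambda>(x, t). u x t)"
  proof (rule viscosity_subsolution_mono[OF sub])
    fix z :: "(real ^ 'n) \<times> real" and P :: "(real ^ 'n) \<times> real"
    obtain p q where P: "P = (p, q)" by fastforce
    assume "evolution_operator (\<lambda>x p. H p) z P \<le> 0"
    then have "q \<le> - H p" by (simp add: evolution_operator_def P split: prod.splits)
    then have "(t - s) * q \<le> (t - s) * - H p" using \<open>s < t\<close> by (intro mult_left_mono) auto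
    then show "P \<bullet> (y - x, t - s) - l \<le> 0"
      using fenchel[of p] by (simp add: P inner_Pair algebra_simps)
  qed (auto intro: open_Times)
  moreover have "closed_segment (x, s) ((x, s) + (y - x, t - s)) \<subseteq> UNIV \<times> {0<..}"
  proof (rule closed_segment_subset)
    show "convex (UNIV \<times> {0<..} :: ((real ^ 'n) \<times> real) set)"
      by (intro convex_Times) auto
  qed (use assms in auto)
  ultimately have "(\<lambda>(x, t). u x t) ((x, s) + (y - x, t - s)) \<le> (\<lambda>(x, t). u x t) (x, s) + l"
    using assms
    by (intro viscosity_subsolution_along_segment[where S = "UNIV \<times> {0<..}"])
      (auto simp: zero_prod_def intro: open_Times continuous_on_subset[OF cont])
  then show ?thesis by simp
qed

text \<open>If \<open>u x0 t0 < 0\<close>, the minimum of \<open>u + L (x0 - y) / (T - s)\<close> over a large cylinder lies on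
  the lateral boundary, since the second term is the negative of a classical solution of the
  equation for \<open>K \<ge> H\<close>. The subsolution property then transports the minimum along a straight
  line to a point at distance 1 from \<open>x0\<close>. There \<open>u\<close> would be at most a negative multiple of the
  radius of the cylinder, so no growth condition on \<open>u\<close> is needed.\<close>

lemma homogeneous_Cauchy_nonneg:
  fixes u :: "real ^ 'n \<Rightarrow> real \<Rightarrow> real"
  assumes sol: "state_constraint_Cauchy_solution (\<lambda>x p. H p) UNIV (\<lambda>x. 0) u"
    and homH: "\<And>t p. t > 0 \<Longrightarrow> H (t *\<^sub>R p) = t\<^sup>2 * H p"
    and conjugate: "\<And>\<kappa>. \<kappa> > 1 \<Longrightarrow> \<exists>L P. C1_gradient L P \<and> (\<forall>q. H (P q) \<le> L q) \<and>
        (\<forall>p q. p \<bullet> q - H p \<le> \<kappa> * L q) \<and> (\<forall>t q. t > 0 \<longrightarrow> L (t *\<^sub>R q) = t\<^sup>2 * L q) \<and>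
        (\<forall>q. (norm q)\<^sup>2 / 4 \<le> L q)"
    and "t0 > 0"
  shows "u x0 t0 \<ge> 0"
proof (rule ccontr)
  assume "\<not> u x0 t0 \<ge> 0"
  then have neg: "u x0 t0 < 0" by simp
  define U where "U z = u (fst z) (snd z)" for z
  have cont: "continuous_on (UNIV \<times> {0..}) (\<lambda>(x, t). u x t)"
    and sub: "viscosity_subsolution (evolution_operator (\<lambda>x p. H p)) (UNIV \<times> {0<..}) (\<lambda>(x, t). u x t)"
    and super: "viscosity_supersolution (evolution_operator (\<lambda>x p. H p)) (UNIV \<times> {0<..}) (\<lambda>(x, t). u x t)"
    and u0: "\<And>x. u x 0 = 0"
    using sol by (auto simp: state_constraint_Cauchy_solution_def)
  have contU: "continuous_on X U" if "X \<subseteq> UNIV \<times> {0..}" for X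
    using continuous_on_subset[OF cont that] by (simp add: U_def case_prod_unfold)
  \<comment> \<open>The pole \<open>T\<close> lies above the top \<open>T'\<close> of the cylinder,
    and \<open>t0 < T'\<close> allows a barrier that is small at \<open>t0\<close> and exceeds the
    bound for \<open>u\<close> at \<open>T'\<close>.\<close>
  define T where "T = t0 + 1"
  define T' where "T' = t0 + 1 / 2"
  have TT: "0 < T'" "t0 < T'" "T' < T" "0 < T" using \<open>t0 > 0\<close> by (auto simp: T_def T'_def)
  have bdd: "\<exists>B\<ge>0. \<forall>z\<in>cball x0 r \<times> {0..T}. \<bar>U z\<bar> \<le> B" for r
  proof -
    have "compact (U ` (cball x0 r \<times> {0..T}))"
      by (intro compact_continuous_image contU compact_Times) auto
    then obtain B where "\<forall>x\<in>U ` (cball x0 r \<times> {0..T}). norm x \<le> B"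
      using compact_imp_bounded bounded_iff by blast
    then show ?thesis by (intro exI[of _ "max B 0"]) (auto simp: le_max_iff_disj)
  qed
  obtain B1 where B1: "B1 \<ge> 0" "\<And>z. z \<in> cball x0 1 \<times> {0..T} \<Longrightarrow> \<bar>U z\<bar> \<le> B1"
    using bdd[of 1] by blast
  \<comment> \<open>\<open>B1\<close> concerns only the unit ball, so \<open>R\<close> can be chosen
    after it. The second summand serves \<open>R / (8 * T) > B1\<close> at the end, the first keeps
    \<open>\<theta> = 1 / R\<close> at most 1/2.\<close>
  define R where "R = 2 + 8 * T * (B1 + 1)"
  have R: "R \<ge> 2" using TT B1 by (simp add: R_def)
  define \<theta> where "\<theta> = 1 / R"
  have \<theta>: "0 < \<theta>" "\<theta> \<le> 1/2" "\<theta> * R = 1" using R by (auto simp: \<theta>_def)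
  obtain L P where C1: "C1_gradient L P" and HL: "\<And>q. H (P q) \<le> L q"
    and fenchel: "\<And>p q. p \<bullet> q - H p \<le> (1 + \<theta> / 2) * L q"
    and hom: "\<And>t q. t > 0 \<Longrightarrow> L (t *\<^sub>R q) = t\<^sup>2 * L q"
    and lower: "\<And>q. (norm q)\<^sup>2 / 4 \<le> L q"
  proof -
    have "1 + \<theta> / 2 > 1" using \<theta>(1) by simp
    from conjugate[OF this] obtain L P where "C1_gradient L P" "\<forall>q. H (P q) \<le> L q"
      "\<forall>p q. p \<bullet> q - H p \<le> (1 + \<theta> / 2) * L q" "\<forall>t q. t > 0 \<longrightarrow> L (t *\<^sub>R q) = t\<^sup>2 * L q"
      "\<forall>q. (norm q)\<^sup>2 / 4 \<le> L q" by blast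
    then show thesis by (intro that[of L P]) auto
  qed
  have L0: "L 0 = 0" using hom[of 2 0] by simp
  have Lnn: "L q \<ge> 0" for q using lower[of q] by (smt (verit) divide_nonneg_nonneg zero_le_power2)
  have contL: "continuous_on X L" for X
    using C1 by (intro has_derivative_continuous_on[OF has_derivative_at_withinI])
      (auto simp: C1_gradient_def gderiv_def)
  have contP: "continuous_on UNIV P" using C1 by (simp add: C1_gradient_def)
  \<comment> \<open>This bound on the large cylinder depends on \<open>R\<close> in an unknown way;
    it enters only through the barrier, and the final estimate does not see it.\<close>
  obtain B where B: "B \<ge> 0" "\<And>z. z \<in> cball x0 R \<times> {0..T} \<Longrightarrow> \<bar>U z\<bar> \<le> B"
    using bdd[of R] by blast
  have "(\<lambda>m. (B + 1) * (t0 / T') ^ m) \<longlonglongrightarrow> (B + 1) * 0"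
    using TT \<open>t0 > 0\<close> by (intro tendsto_intros LIMSEQ_realpow_zero) auto
  then have "\<forall>\<^sub>F m in sequentially. (B + 1) * (t0 / T') ^ m < - u x0 t0"
    using neg by (intro order_tendstoD) auto
  then obtain m where m: "(B + 1) * (t0 / T') ^ Suc m < - u x0 t0"
    unfolding eventually_sequentially by (meson le_SucI order_refl)
  define barrier where "barrier s = (B + 1) * (s / T') ^ Suc m" for s
  define F where "F z = U z + L (x0 - fst z) / (T - snd z) + barrier (snd z)" for z
  define K where "K = cball x0 R \<times> {0..T'}"
  have "compact K" unfolding K_def by (intro compact_Times) auto
  have contF: "continuous_on K F" unfolding F_def barrier_def
    using TT by (intro continuous_intros contU continuous_on_compose2[OF contL[of UNIV]]) (auto simp: K_def)
  have start: "(x0, t0) \<in> K" using R TT \<open>t0 > 0\<close> by (auto simp: K_def)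
  then obtain z where z: "z \<in> K" and zmin: "\<And>y. y \<in> K \<Longrightarrow> F z \<le> F y"
    using continuous_attains_inf[OF \<open>compact K\<close> _ contF] by blast
  obtain y s where zy: "z = (y, s)" by fastforce
  have ys: "dist x0 y \<le> R" "0 \<le> s" "s \<le> T'" using z by (auto simp: K_def zy)
  have "F (x0, t0) < 0" using m L0 by (simp add: F_def U_def barrier_def)
  then have Fz: "F z < 0" using zmin[OF start] by simp
  have Lpart: "0 \<le> L (x0 - y) / (T - s)" using Lnn ys TT by simp
  have bar: "0 \<le> barrier s" using ys TT B by (simp add: barrier_def)
  have "s \<noteq> 0"
    using Fz Lpart bar u0 by (auto simp: F_def U_def zy)
  have "s \<noteq> T'"
  proof
    assume "s = T'"
    then have "barrier s = B + 1" using TT by (simp add: barrier_def)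
    moreover have "\<bar>U z\<bar> \<le> B" using B(2)[of z] ys TT by (simp add: zy)
    ultimately show False using Fz Lpart by (simp add: F_def zy)
  qed
  have s: "0 < s" "s < T'" using ys \<open>s \<noteq> 0\<close> \<open>s \<noteq> T'\<close> by auto
  \<comment> \<open>Inside the ball the supersolution test would apply:
    \<open>H (P q) \<le> L q\<close> makes the contribution of \<open>L\<close> to the operator at
    most 0, and the growing barrier makes the total strictly negative.\<close>
  have lateral: "dist x0 y = R"
  proof (rule ccontr)
    assume "dist x0 y \<noteq> R"
    then have inball: "dist x0 y < R" using ys by simp
    define a where "a = T - s"
    have a: "a > 0" using s TT by (simp add: a_def)
    define Q where "Q r = 1 / a + 1 / a\<^sup>2 * (r - s) + 2 / a ^ 3 * (r - s)\<^sup>2" for r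
    define Q' where "Q' r = 1 / a\<^sup>2 + 2 * (2 / a ^ 3) * (r - s)" for r
    define \<phi> where "\<phi> y = - L (x0 - fst y) * Q (snd y) - barrier (snd y)" for y
    define G where "G y = (Q (snd y) *\<^sub>R P (x0 - fst y),
        - L (x0 - fst y) * Q' (snd y) - (B + 1) * ((1 + real m) * (snd y / T') ^ m / T'))" for y
    have dL: "((\<lambda>y. L (x0 - fst y)) has_derivative (\<lambda>h. - fst h \<bullet> P (x0 - fst y))) (at y)" for y
    proof -
      have "(L has_derivative (\<lambda>h. h \<bullet> P (x0 - fst y))) (at (x0 - fst y))"
        using C1 by (simp add: C1_gradient_def gderiv_def)
      moreover have "((\<lambda>y. x0 - fst y) has_derivative (\<lambda>h. - fst h)) (at y)"
        by (auto intro!: derivative_eq_intros)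
      ultimately show ?thesis
        using has_derivative_compose by fastforce
    qed
    have "((\<lambda>r. \<alpha> + \<beta> * (r - s) + \<gamma> * (r - s)\<^sup>2) has_real_derivative \<beta> + 2 * \<gamma> * (r - s)) (at r)"
      for \<alpha> \<beta> \<gamma> r by (auto intro!: derivative_eq_intros)
    then have dQ: "(Q has_real_derivative Q' r) (at r)" for r
      unfolding Q_def Q'_def .
    have dbar: "(barrier has_real_derivative (B + 1) * ((1 + real m) * (r / T') ^ m / T')) (at r)" for r
      unfolding barrier_def by (rule DERIV_cong[OF DERIV_cmult[OF DERIV_power_Suc[OF DERIV_cdivide[OF DERIV_ident]]]]) simp
    have comp_snd: "((\<lambda>y. f (snd y)) has_derivative (\<lambda>h. snd h * f')) (at y)"
      if "(f has_real_derivative f') (at (snd y))" for f f' and y :: "(real ^ 'n) \<times> real"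
      using has_derivative_compose[OF has_derivative_snd[OF has_derivative_ident]
          that[unfolded has_field_derivative_def], of UNIV] by (simp add: mult.commute)
    have "C1_gradient \<phi> G"
      unfolding C1_gradient_def
    proof
      show "\<forall>y. GDERIV \<phi> y :> G y"
      proof
        fix y
        show "GDERIV \<phi> y :> G y"
          unfolding gderiv_def \<phi>_def G_def
          by (rule has_derivative_eq_rhs, rule has_derivative_diff[OF has_derivative_mult[OF
                  has_derivative_minus[OF dL] comp_snd[OF dQ]] comp_snd[OF dbar]])
            (auto simp: inner_prod_def algebra_simps)
      qed
      have contfst: "continuous_on UNIV (\<lambda>y. P (x0 - fst y))" "continuous_on UNIV (\<lambda>y. L (x0 - fst y))"
        by (intro continuous_on_compose2[OF contP] continuous_on_compose2[OF contL[of UNIV]]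
            continuous_intros subset_UNIV)+
      show "continuous_on UNIV G"
        unfolding G_def Q_def Q'_def using a TT by (intro continuous_intros contfst) auto
    qed
    moreover have "\<forall>\<^sub>F y in at z within UNIV \<times> {0<..}. U y - \<phi> y \<ge> U z - \<phi> z"
    proof -
      define N where "N = ball x0 R \<times> {0<..<min T' ((s + T) / 2)}"
      have "open N" unfolding N_def by (intro open_Times) auto
      moreover have "z \<in> N" using inball s TT by (simp add: N_def zy)
      ultimately have "\<forall>\<^sub>F y in nhds z. y \<in> N" by (rule eventually_nhds_in_open)
      then show ?thesis
        unfolding eventually_at_filter
      proof eventually_elim
        case (elim y')
        then have y': "y' \<in> K" "snd y' \<le> (s + T) / 2" by (auto simp: N_def K_def)
        have "1 / (T - snd y') \<le> Q (snd y')"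
          using quadratic_above_reciprocal[of s T "snd y'"] y' s TT by (simp add: Q_def a_def)
        then have "L (x0 - fst y') * (1 / (T - snd y')) \<le> L (x0 - fst y') * Q (snd y')"
          using Lnn by (rule mult_left_mono)
        then have "F y' \<le> U y' - \<phi> y'" by (simp add: F_def \<phi>_def)
        moreover have "F z = U z - \<phi> z" by (simp add: F_def \<phi>_def zy Q_def a_def)
        ultimately show ?case using zmin[OF y'(1)] by simp
      qed
    qed
    moreover have "z \<in> UNIV \<times> {0<..}" using s by (simp add: zy)
    ultimately have "evolution_operator (\<lambda>x p. H p) z (G z) \<ge> 0"
      using super unfolding viscosity_supersolution_def U_def case_prod_unfold by blast
    moreover have "G z = ((1 / a) *\<^sub>R P (x0 - y), - L (x0 - y) / a\<^sup>2 - (B + 1) * ((1 + real m) * (s / T') ^ m / T'))"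
      by (simp add: G_def zy Q_def Q'_def)
    moreover have "H ((1 / a) *\<^sub>R P (x0 - y)) \<le> L (x0 - y) / a\<^sup>2"
      using homH[of "1 / a" "P (x0 - y)"] HL[of "x0 - y"] a
      by (simp add: power_divide divide_right_mono)
    moreover have "(B + 1) * ((1 + real m) * (s / T') ^ m / T') > 0"
      using B s TT by simp
    ultimately show False by (simp add: evolution_operator_def zy)
  qed
  \<comment> \<open>The point of the segment from \<open>(y, s)\<close> to \<open>(x0, T)\<close>
    where the fraction \<theta> remains: its distance to \<open>x0\<close> is
    \<open>\<theta> * R = 1\<close>. Its time may exceed \<open>T'\<close> but not \<open>T\<close>,
    hence the time range in \<open>B1\<close>.\<close>
  define y' where "y' = x0 + \<theta> *\<^sub>R (y - x0)"
  define s' where "s' = T - \<theta> * (T - s)"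
  have Ts: "T - s > 0" using s TT by simp
  have "0 < (1 - \<theta>) * (T - s)" using \<theta> Ts by simp
  then have s': "s < s'" "s' - s = (1 - \<theta>) * (T - s)" "s' \<le> T"
    using \<theta> Ts by (auto simp: s'_def algebra_simps)
  have yy: "y' - y = (1 - \<theta>) *\<^sub>R (x0 - y)" by (simp add: y'_def algebra_simps)
  have "u y' s' \<le> u y s + (1 - \<theta>) * ((1 + \<theta> / 2) * (L (x0 - y) / (T - s)))"
  proof (rule evolution_subsolution_increment[OF cont sub _ s(1) s'(1)])
    fix p
    have "p \<bullet> ((1 / (T - s)) *\<^sub>R (x0 - y)) - H p \<le> (1 + \<theta> / 2) * (L (x0 - y) / (T - s)\<^sup>2)"
      using fenchel[of p "(1 / (T - s)) *\<^sub>R (x0 - y)"] Ts by (simp add: hom power_divide)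
    then have "(T - s) * (p \<bullet> ((1 / (T - s)) *\<^sub>R (x0 - y)) - H p)
        \<le> (T - s) * ((1 + \<theta> / 2) * (L (x0 - y) / (T - s)\<^sup>2))"
      using Ts by (intro mult_left_mono) auto
    moreover have "(T - s) * (p \<bullet> ((1 / (T - s)) *\<^sub>R (x0 - y)) - H p) = p \<bullet> (x0 - y) - (T - s) * H p"
      using Ts by (simp add: right_diff_distrib[of "T - s"])
    moreover have "(T - s) * ((1 + \<theta> / 2) * (L (x0 - y) / (T - s)\<^sup>2)) = (1 + \<theta> / 2) * (L (x0 - y) / (T - s))"
      using Ts by (simp add: power2_eq_square)
    ultimately have "p \<bullet> (x0 - y) - (T - s) * H p \<le> (1 + \<theta> / 2) * (L (x0 - y) / (T - s))"
      by (simp only:)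
    then have "(1 - \<theta>) * (p \<bullet> (x0 - y) - (T - s) * H p)
        \<le> (1 - \<theta>) * ((1 + \<theta> / 2) * (L (x0 - y) / (T - s)))"
      using \<theta> by (intro mult_left_mono) auto
    moreover have "p \<bullet> (y' - y) - (s' - s) * H p = (1 - \<theta>) * (p \<bullet> (x0 - y) - (T - s) * H p)"
      unfolding yy s'(2) by (simp add: right_diff_distrib)
    ultimately show "p \<bullet> (y' - y) - (s' - s) * H p \<le> (1 - \<theta>) * ((1 + \<theta> / 2) * (L (x0 - y) / (T - s)))"
      by (simp only:)
  qed
  also have "(1 - \<theta>) * ((1 + \<theta> / 2) * (L (x0 - y) / (T - s))) \<le> (1 - \<theta> / 2) * (L (x0 - y) / (T - s))"
  proof -
    have "(1 - \<theta>) * (1 + \<theta> / 2) \<le> 1 - \<theta> / 2" by (simp add: algebra_simps)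
    from mult_right_mono[OF this Lpart] show ?thesis by (simp only: mult.assoc)
  qed
  finally have "U (y', s') \<le> U z + (1 - \<theta> / 2) * (L (x0 - y) / (T - s))"
    by (simp add: U_def zy)
  moreover have "U z + L (x0 - y) / (T - s) < 0" using Fz bar by (simp add: F_def zy)
  \<comment> \<open>The quadratic lower bound for \<open>L\<close> times
    \<open>\<theta> = 1 / R\<close> leaves a term linear in \<open>R\<close>.\<close>
  moreover have "\<theta> / 2 * (L (x0 - y) / (T - s)) \<ge> R / (8 * T)"
  proof -
    have "R\<^sup>2 / 4 \<le> L (x0 - y)" using lower[of "x0 - y"] lateral by (simp add: dist_norm)
    then have "R\<^sup>2 / 4 / T \<le> L (x0 - y) / (T - s)"
      using Ts s TT by (intro frac_le) (auto simp: Lnn)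
    then have "\<theta> / 2 * (R\<^sup>2 / 4 / T) \<le> \<theta> / 2 * (L (x0 - y) / (T - s))"
      using \<theta> by (intro mult_left_mono) auto
    then show ?thesis using \<theta>(3) R TT by (simp add: \<theta>_def power2_eq_square)
  qed
  moreover have "R / (8 * T) > B1" using TT B1 by (simp add: R_def pos_less_divide_eq algebra_simps)
  moreover have "\<bar>U (y', s')\<bar> \<le> B1"
  proof (rule B1(2))
    have "dist x0 y' = \<theta> * dist x0 y"
      using \<theta> by (simp add: y'_def dist_norm norm_minus_commute)
    then show "(y', s') \<in> cball x0 1 \<times> {0..T}" using lateral \<theta> s s' by simp
  qed
  ultimately show False unfolding left_diff_distrib by linarith
qed

section \<open>Periodically perforated space\<close>

lemma axis_in_int_lattice: "axis i 1 \<in> int_lattice"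
  by (simp add: int_lattice_def axis_def)

lemma int_lattice_eqI:
  assumes "m \<in> int_lattice" "m' \<in> int_lattice" and "\<And>i. \<bar>m $ i - m' $ i\<bar> < 1"
  shows "m = m'"
proof (simp add: vec_eq_iff, rule allI)
  fix i
  have "m $ i - m' $ i \<in> \<int>" using assms(1,2) by (simp add: int_lattice_def)
  then have "m $ i - m' $ i = 0" using assms(3)[of i] Ints_nonzero_abs_less1 by blast
  then show "m $ i = m' $ i" by simp
qed

lemma open_unit_cube_lattice_unique:
  assumes "m \<in> int_lattice" "m' \<in> int_lattice"
    and "x - m \<in> open_unit_cube" "x - m' \<in> open_unit_cube"
  shows "m = m'"
proof (rule int_lattice_eqI[OF assms(1,2)])
  fix i
  have "- 1/2 < x $ i - m $ i" "x $ i - m $ i < 1/2" "- 1/2 < x $ i - m' $ i" "x $ i - m' $ i < 1/2"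
    using assms(3,4) by (auto simp: open_unit_cube_def)
  then show "\<bar>m $ i - m' $ i\<bar> < 1" by linarith
qed

lemma open_unit_cube_eq_box:
  "open_unit_cube = box (\<chi> i. - (1/2)) ((\<chi> i. 1/2) :: real ^ 'n)"
  by (auto simp: open_unit_cube_def mem_box_cart)

lemma mem_perforated: "x \<in> perforated D M \<longleftrightarrow> (\<forall>m\<in>M. x - m \<notin> closure D)"
proof -
  have "x \<in> (\<lambda>y. m + y) ` closure D \<longleftrightarrow> x - m \<in> closure D" for m
  proof
    assume "x - m \<in> closure D"
    then show "x \<in> (\<lambda>y. m + y) ` closure D" by (intro image_eqI[of _ _ "x - m"]) auto
  qed auto
  then show ?thesis by (simp add: perforated_def)
qed

text \<open>Lattice points are 1-separated, so \<open>M\<close> is closed, and a closed set plus a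
  compact set is closed.\<close>

lemma open_perforated:
  fixes D :: "(real ^ 'n) set"
  assumes "bounded D" and "M \<subseteq> int_lattice"
  shows "open (perforated D M)"
proof -
  have "closed M"
  proof (rule discrete_imp_closed[of 1])
    show "\<forall>x\<in>M. \<forall>y\<in>M. dist y x < 1 \<longrightarrow> y = x"
    proof (intro ballI impI int_lattice_eqI)
      fix x y i assume "x \<in> M" "y \<in> M" "dist y x < 1"
      then show "\<bar>y $ i - x $ i\<bar> < 1"
        using component_le_norm_cart[of "y - x" i] by (simp add: dist_norm)
    qed (use assms(2) in blast)+
  qed simp
  moreover have "compact (closure D)" using assms(1) by simp
  ultimately have "closed (\<Union>m\<in>M. \<Union>y\<in>closure D. {m + y})" by (rule closed_compact_sums)
  moreover have "perforated D M = - (\<Union>m\<in>M. \<Union>y\<in>closure D. {m + y})"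
    by (auto simp: perforated_def)
  ultimately show ?thesis by (simp only: open_Compl)
qed

section \<open>Topology and periodicity of the complement of all holes\<close>

locale perforation =
  fixes D \<Omega> :: "(real ^ 'n) set"
  assumes open_D: "open D" and closure_D: "closure D \<subseteq> open_unit_cube"
    and Omega: "\<Omega> = perforated D int_lattice"
begin

lemma bounded_D: "bounded D"
  by (rule bounded_subset[OF bounded_box order_trans[OF closure_subset closure_D[unfolded open_unit_cube_eq_box]]])

lemma open_Omega: "open \<Omega>"
  unfolding Omega by (rule open_perforated[OF bounded_D order_refl])

text \<open>A corner of the unit cube serves as base point: the centre of a hole covering it would
  have all coordinates strictly between 0 and 1, where there is no integer.\<close>

lemma Omega_nonempty: "(\<chi> i. 1/2) \<in> \<Omega>"
  unfolding Omega mem_perforated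
proof (intro ballI notI)
  fix m :: "real ^ 'n" assume "m \<in> int_lattice" "(\<chi> i. 1/2) - m \<in> closure D"
  then have m: "m $ i \<in> \<int>" "0 < m $ i" "m $ i < 1" for i
    using subsetD[OF closure_D, of "(\<chi> i. 1/2) - m"] by (auto simp: int_lattice_def open_unit_cube_def)
  fix i
  have "m $ i = 0" using m[of i] by (intro Ints_nonzero_abs_less1) auto
  then show False using m(2)[of i] by simp
qed

lemma Omega_translate: "x + m \<in> \<Omega>" if "x \<in> \<Omega>" "m \<in> int_lattice"
  unfolding Omega mem_perforated
proof
  fix m' :: "real ^ 'n" assume "m' \<in> int_lattice"
  then have "m' - m \<in> int_lattice" using that by (simp add: int_lattice_def)
  then have "x - (m' - m) \<notin> closure D" using that(1) unfolding Omega mem_perforated by blast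
  then show "x + m - m' \<notin> closure D" by (simp add: algebra_simps)
qed

lemma closure_Omega_translate: "x + m \<in> closure \<Omega>" if "x \<in> closure \<Omega>" "m \<in> int_lattice"
proof -
  have "(+) m ` \<Omega> \<subseteq> \<Omega>" using Omega_translate that(2) by (auto simp: add.commute)
  then have "closure ((+) m ` \<Omega>) \<subseteq> closure \<Omega>" by (rule closure_mono)
  then have "(+) m ` closure \<Omega> \<subseteq> closure \<Omega>" by (simp add: closure_translation)
  then show ?thesis using that(1) by (auto simp: add.commute)
qed

text \<open>The open hole misses \<Omega>, hence also its closure. For \<open>m = 0\<close> this
  puts the origin where \<open>V\<close> is positive.\<close>

lemma closure_Omega_avoids_holes:
  assumes "x \<in> closure \<Omega>" "m \<in> int_lattice"
  shows "x - m \<notin> D"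
proof
  assume "x - m \<in> D"
  have "(\<lambda>y. y - m) -` D \<inter> \<Omega> = {}"
    using assms(2) closure_subset[of D] by (auto simp: Omega mem_perforated)
  moreover have "open ((\<lambda>y. y - m) -` D)"
    by (intro open_vimage open_D continuous_intros)
  ultimately have "(\<lambda>y. y - m) -` D \<inter> closure \<Omega> = {}"
    by (simp only: open_Int_closure_eq_empty)
  then show False using assms(1) \<open>x - m \<in> D\<close> by auto
qed

lemma periodic_attains_inf:
  assumes cont: "continuous_on (closure \<Omega>) f" and per: "lattice_periodic_on (closure \<Omega>) f"
  obtains x where "x \<in> closure \<Omega>" and "\<And>y. y \<in> closure \<Omega> \<Longrightarrow> f x \<le> f y"
proof -
  define Q where "Q = closure \<Omega> \<inter> cbox 0 ((\<chi> i. 1) :: real ^ 'n)"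
  have rep: "\<exists>m\<in>int_lattice. y + m \<in> Q" if "y \<in> closure \<Omega>" for y
  proof
    let ?m = "(\<chi> i. - of_int \<lfloor>y $ i\<rfloor>) :: real ^ 'n"
    show m: "?m \<in> int_lattice" by (simp add: int_lattice_def)
    have "0 \<le> y $ i - of_int \<lfloor>y $ i\<rfloor> \<and> y $ i - of_int \<lfloor>y $ i\<rfloor> \<le> 1" for i
      using floor_correct[of "y $ i"] by linarith
    then have "y + ?m \<in> cbox 0 (\<chi> i. 1)" by (simp add: mem_box_cart)
    then show "y + ?m \<in> Q" using closure_Omega_translate[OF that m] by (simp add: Q_def)
  qed
  have "compact Q" unfolding Q_def by (intro closed_Int_compact) auto
  moreover have "Q \<noteq> {}" using rep[OF subsetD[OF closure_subset Omega_nonempty]] by auto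
  moreover have "continuous_on Q f" using cont by (rule continuous_on_subset) (auto simp: Q_def)
  ultimately obtain x where x: "x \<in> Q" "\<And>y. y \<in> Q \<Longrightarrow> f x \<le> f y"
    using continuous_attains_inf[of Q f] by blast
  have "f x \<le> f y" if "y \<in> closure \<Omega>" for y
  proof -
    obtain m where m: "m \<in> int_lattice" "y + m \<in> Q" using rep \<open>y \<in> closure \<Omega>\<close> by blast
    then have "f (y + m) = f y" using per that by (simp add: lattice_periodic_on_def Q_def)
    then show ?thesis using x(2)[OF m(2)] by simp
  qed
  then show thesis using that x(1) by (auto simp: Q_def)
qed

end

section \<open>Interior cones from the C1 boundary\<close>

lemma C1_gradient_lipschitz:
  assumes "C1_gradient \<gamma> G"
  shows "\<exists>\<Lambda>\<ge>0. \<forall>a\<in>cball c r. \<forall>b\<in>cball c r. \<bar>\<gamma> a - \<gamma> b\<bar> \<le> \<Lambda> * norm (a - b)"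
proof -
  have "compact (G ` cball c r)"
    using assms by (intro compact_continuous_image)
      (auto simp: C1_gradient_def intro: continuous_on_subset)
  from compact_imp_bounded[OF this] obtain \<Lambda> where "\<forall>y\<in>G ` cball c r. norm y \<le> \<Lambda>"
    unfolding bounded_iff by blast
  then have \<Lambda>: "\<And>z. z \<in> cball c r \<Longrightarrow> norm (G z) \<le> \<Lambda>" by blast
  have "norm (\<gamma> a - \<gamma> b) \<le> max \<Lambda> 0 * norm (a - b)" if "a \<in> cball c r" "b \<in> cball c r" for a b
  proof (rule differentiable_bound[OF convex_cball _ _ that])
    fix z assume z: "z \<in> cball c r"
    show "(\<gamma> has_derivative (\<lambda>h. h \<bullet> G z)) (at z within cball c r)"
      using assms by (auto simp: C1_gradient_def gderiv_def intro: has_derivative_at_withinI)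
    show "onorm (\<lambda>h. h \<bullet> G z) \<le> max \<Lambda> 0"
    proof (rule onorm_bound)
      fix h
      have "norm (h \<bullet> G z) \<le> norm h * norm (G z)" using Cauchy_Schwarz_ineq2[of h "G z"] by simp
      also have "\<dots> \<le> norm h * max \<Lambda> 0" using \<Lambda>[OF z] by (intro mult_left_mono) auto
      finally show "norm (h \<bullet> G z) \<le> max \<Lambda> 0 * norm h" by (simp add: mult.commute)
    qed simp
  qed
  then show ?thesis by (intro exI[of _ "max \<Lambda> 0"]) (simp del: mem_cball)
qed

text \<open>Near a boundary point the hole is a strict epigraph in direction \<nu>, so
  \<open>e = - \<nu>\<close> leads out of it. With a Lipschitz constant \<Lambda> of \<gamma>, a
  perturbation \<open>d\<close> costs at most \<open>(1 + \<Lambda>) * norm d\<close> against the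
  gain 1, uniformly in \<open>x\<close>. The cone provides the shift for the doubling of
  variables.\<close>

lemma (in perforation) interior_cone:
  assumes C1: "C1_boundary D" and x0: "x0 \<in> closure \<Omega>"
  obtains e \<theta> \<rho> where "\<theta> > 0" "\<rho> > 0"
    and "\<And>x h d. x \<in> closure \<Omega> \<Longrightarrow> dist x x0 < \<rho> \<Longrightarrow> 0 < h \<Longrightarrow> h < \<rho> \<Longrightarrow> norm d \<le> \<theta> \<Longrightarrow>
          x + h *\<^sub>R (e + d) \<in> \<Omega>"
proof (cases "x0 \<in> \<Omega>")
  case True
  then obtain \<delta> where \<delta>: "\<delta> > 0" "ball x0 \<delta> \<subseteq> \<Omega>" using openE[OF open_Omega] by metis
  show thesis
  proof (rule that[of 1 "\<delta> / 2" 0])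
    fix h :: real and x d :: "real ^ 'n"
    assume "dist x x0 < \<delta> / 2" "0 < h" "h < \<delta> / 2" "norm d \<le> 1"
    have "norm (h *\<^sub>R d) \<le> h * 1" using \<open>0 < h\<close> \<open>norm d \<le> 1\<close> by simp
    then have "dist x0 (x + h *\<^sub>R d) < \<delta>"
      using \<open>dist x x0 < \<delta> / 2\<close> \<open>h < \<delta> / 2\<close> dist_triangle[of x0 "x + h *\<^sub>R d" x]
      by (simp add: dist_commute dist_norm)
    then show "x + h *\<^sub>R (0 + d) \<in> \<Omega>" using \<delta>(2) by auto
  qed (use \<delta> in auto)
next
  case False
  then obtain m where m: "m \<in> int_lattice" "x0 - m \<in> closure D" by (auto simp: Omega mem_perforated)
  define x1 where "x1 = x0 - m"
  have "x1 \<in> frontier D"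
    using m closure_Omega_avoids_holes[OF x0 m(1)] open_D by (simp add: frontier_def interior_open x1_def)
  then obtain r \<nu> \<gamma> G where r: "r > 0" and \<nu>: "norm \<nu> = 1" and \<gamma>: "C1_gradient \<gamma> G"
    and epi: "D \<inter> ball x1 r = {y \<in> ball x1 r. \<gamma> (y - (y \<bullet> \<nu>) *\<^sub>R \<nu>) < y \<bullet> \<nu>}"
    using C1[unfolded C1_boundary_def, rule_format, of x1] by blast
  \<comment> \<open>Within the open unit cube around \<open>m\<close> no other hole occurs, so a
    small ball leaves a single hole to avoid.\<close>
  have "x1 \<in> open_unit_cube" using m(2) closure_D by (auto simp: x1_def)
  then obtain r2 where r2: "r2 > 0" "ball x1 r2 \<subseteq> open_unit_cube" 
    using openE[OF open_box[of "\<chi> i. - (1/2)" "(\<chi> i. 1/2) :: real ^ 'n"]]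
    unfolding open_unit_cube_eq_box by metis
  define r0 where "r0 = min r r2"
  have r0: "r0 > 0" "r0 \<le> r" "r0 \<le> r2" using r r2 by (auto simp: r0_def)
  define \<pi> where "\<pi> y = y - (y \<bullet> \<nu>) *\<^sub>R \<nu>" for y
  have epi': "y \<in> D \<longleftrightarrow> \<gamma> (\<pi> y) < y \<bullet> \<nu>" if "y \<in> ball x1 r" for y
  proof -
    have "y \<in> D \<inter> ball x1 r \<longleftrightarrow> \<gamma> (\<pi> y) < y \<bullet> \<nu>" unfolding epi using that by (simp add: \<pi>_def)
    then show ?thesis using that by blast
  qed
  have \<nu>\<nu>: "\<nu> \<bullet> \<nu> = 1" using \<nu> by (simp add: norm_eq_1)
  have \<pi>_norm: "norm (\<pi> y) \<le> norm y" for y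
  proof -
    have "\<pi> y \<bullet> \<pi> y = y \<bullet> y - (y \<bullet> \<nu>)\<^sup>2"
      by (simp add: \<pi>_def inner_simps \<nu>\<nu> inner_commute power2_eq_square)
    then show ?thesis by (simp add: norm_le)
  qed
  have \<pi>_diff: "\<pi> a - \<pi> b = \<pi> (a - b)" for a b by (simp add: \<pi>_def inner_simps algebra_simps)
  have \<pi>_scale: "\<pi> (s *\<^sub>R a) = s *\<^sub>R \<pi> a" for s a by (simp add: \<pi>_def inner_simps algebra_simps)
  have \<pi>_add: "\<pi> (a + b) = \<pi> a + \<pi> b" for a b by (simp add: \<pi>_def inner_simps algebra_simps)
  have \<pi>_\<nu>: "\<pi> (- \<nu>) = 0" by (simp add: \<pi>_def \<nu>\<nu>)
  have cont\<gamma>: "continuous_on UNIV \<gamma>"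
    using \<gamma> by (intro has_derivative_continuous_on[OF has_derivative_at_withinI])
      (auto simp: C1_gradient_def gderiv_def)
  obtain \<Lambda> where \<Lambda>: "\<Lambda> \<ge> 0"
    "\<And>a b. a \<in> cball (\<pi> x1) r0 \<Longrightarrow> b \<in> cball (\<pi> x1) r0 \<Longrightarrow> \<bar>\<gamma> a - \<gamma> b\<bar> \<le> \<Lambda> * norm (a - b)"
    using C1_gradient_lipschitz[OF \<gamma>, of "\<pi> x1" r0] by blast
  \<comment> \<open>Half of the gain along \<open>- \<nu>\<close> is reserved for the
    perturbation.\<close>
  define \<theta> where "\<theta> = 1 / (2 * (1 + \<Lambda>))"
  have \<theta>: "\<theta> > 0" "(1 + \<Lambda>) * \<theta> = 1 / 2" using \<Lambda>(1) by (simp_all add: \<theta>_def)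
  have \<theta>_le: "\<theta> \<le> 1 / 2" unfolding \<theta>_def using \<Lambda>(1) by (intro divide_left_mono) auto
  \<comment> \<open>The graph of \<gamma> belongs to \<open>closure D\<close>; the region strictly
    below it is open, and therefore misses \<open>closure D\<close> as soon as it misses
    \<open>D\<close>.\<close>
  have disj: "z \<notin> closure D" if "z \<in> ball x1 r" "\<gamma> (\<pi> z) > z \<bullet> \<nu>" for z
  proof -
    have "open {y. y \<bullet> \<nu> < \<gamma> (\<pi> y)}"
      unfolding \<pi>_def
      by (intro open_Collect_less continuous_intros continuous_on_compose2[OF cont\<gamma>]) auto
    then have o: "open (ball x1 r \<inter> {y. y \<bullet> \<nu> < \<gamma> (\<pi> y)})" by auto
    have "(ball x1 r \<inter> {y. y \<bullet> \<nu> < \<gamma> (\<pi> y)}) \<inter> D = {}" using epi' by fastforce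
    then have "(ball x1 r \<inter> {y. y \<bullet> \<nu> < \<gamma> (\<pi> y)}) \<inter> closure D = {}"
      by (simp only: open_Int_closure_eq_empty[OF o])
    then show ?thesis using that by blast
  qed
  show thesis
  proof (rule that[of \<theta> "r0 / 4" "- \<nu>"])
    fix x d :: "real ^ 'n" and h :: real
    assume x: "x \<in> closure \<Omega>" "dist x x0 < r0 / 4" and h: "0 < h" "h < r0 / 4" and d: "norm d \<le> \<theta>"
    define z where "z = x - m"
    define z' where "z' = z + h *\<^sub>R (- \<nu> + d)"
    have zx: "dist x1 z < r0 / 4" using x(2) by (simp add: z_def x1_def dist_norm norm_minus_commute)
    have "norm (- \<nu> + d) \<le> 2" using norm_triangle_ineq[of "- \<nu>" d] \<nu> d \<theta>_le by simp
    then have "norm (h *\<^sub>R (- \<nu> + d)) \<le> h * 2" using h by simp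
    then have "dist z z' \<le> h * 2" unfolding z'_def by (simp add: dist_norm norm_minus_commute)
    then have z'x: "dist x1 z' < r0" using zx h dist_triangle[of x1 z' z] by simp
    have "z \<notin> D" using closure_Omega_avoids_holes[OF x(1) m(1)] by (simp add: z_def)
    moreover have "z \<in> ball x1 r" using zx r0 by simp
    ultimately have "z \<bullet> \<nu> \<le> \<gamma> (\<pi> z)" using epi' by (simp add: not_less)
    moreover have "\<pi> z' = \<pi> z + h *\<^sub>R \<pi> d" unfolding z'_def \<pi>_add \<pi>_scale \<pi>_\<nu> by simp
    moreover have "\<bar>\<gamma> (\<pi> z') - \<gamma> (\<pi> z)\<bar> \<le> \<Lambda> * norm (\<pi> z' - \<pi> z)"
    proof (rule \<Lambda>(2))
      have "dist (\<pi> x1) (\<pi> y) \<le> dist x1 y" for y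
        using \<pi>_norm[of "x1 - y"] by (simp add: dist_norm \<pi>_diff)
      from this[of z'] this[of z] show "\<pi> z' \<in> cball (\<pi> x1) r0" "\<pi> z \<in> cball (\<pi> x1) r0"
        using zx z'x r0 by auto
    qed
    moreover have "\<Lambda> * norm (h *\<^sub>R \<pi> d) \<le> \<Lambda> * (h * norm d)"
      using \<pi>_norm[of d] h \<Lambda>(1) by (intro mult_left_mono) auto
    ultimately have lo: "\<gamma> (\<pi> z') \<ge> z \<bullet> \<nu> - \<Lambda> * (h * norm d)" by simp
    have "d \<bullet> \<nu> \<le> norm d" using norm_cauchy_schwarz[of d \<nu>] \<nu> by simp
    then have "h * (d \<bullet> \<nu>) \<le> h * norm d" using h by simp
    then have up: "z' \<bullet> \<nu> \<le> z \<bullet> \<nu> - h + h * norm d"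
      by (simp add: z'_def inner_simps \<nu>\<nu> algebra_simps)
    have "(1 + \<Lambda>) * norm d \<le> 1 / 2" using mult_left_mono[OF d, of "1 + \<Lambda>"] \<Lambda>(1) \<theta>(2) by simp
    then have "h * ((1 + \<Lambda>) * norm d) \<le> h * (1 / 2)" using h by (intro mult_left_mono) auto
    then have "z' \<bullet> \<nu> < \<gamma> (\<pi> z')" using lo up h by (simp add: algebra_simps)
    then have "z' \<notin> closure D" using disj z'x r0 by simp
    have z'cube: "z' \<in> open_unit_cube" using z'x r0 r2(2) by auto
    have xz: "x + h *\<^sub>R (- \<nu> + d) = z' + m" by (simp add: z'_def z_def)
    show "x + h *\<^sub>R (- \<nu> + d) \<in> \<Omega>"
      unfolding Omega mem_perforated xz
    proof (intro ballI notI)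
      fix m' assume m': "m' \<in> int_lattice" "z' + m - m' \<in> closure D"
      then have "m = m'"
        using z'cube closure_D by (intro open_unit_cube_lattice_unique[OF m(1), of m' "z' + m"]) auto
      then show False using m'(2) \<open>z' \<notin> closure D\<close> by simp
    qed
  qed (use \<theta> r0 in auto)
qed

section \<open>The effective Hamiltonian\<close>

locale perforated_cell = perforation D \<Omega> for D \<Omega> :: "(real ^ 'n) set" +
  fixes V :: "real ^ 'n \<Rightarrow> real"
  assumes V_zero: "y \<in> closure \<Omega> \<Longrightarrow> V y = 0"
begin

section \<open>Eikonal form of the cell problem and bounds on its constant\<close>

abbreviation "cell \<equiv> cell_problem_solution (mechanical_Hamiltonian V) \<Omega>"

lemma cell_continuous: "cell p c v \<Longrightarrow> continuous_on (closure \<Omega>) v"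
  by (simp add: cell_problem_solution_def)

lemma cell_continuous_Omega: "cell p c v \<Longrightarrow> continuous_on \<Omega> v"
  using cell_continuous closure_subset continuous_on_subset by metis

lemma cell_periodic: "cell p c v \<Longrightarrow> lattice_periodic_on (closure \<Omega>) v"
  by (simp add: cell_problem_solution_def)

text \<open>Since \<open>V\<close> vanishes on \<open>closure \<Omega>\<close>, the cell problem is
  there the eikonal problem for \<open>norm (p + Dv)\<close> at level
  \<open>sqrt (2 * c)\<close>.\<close>

lemma cell_subsolution:
  assumes "cell p c v" "z \<in> \<Omega>" "C1_gradient \<phi> G" "\<forall>\<^sub>F y in at z. v y - \<phi> y \<le> v z - \<phi> z"
  shows "(norm (p + G z))\<^sup>2 \<le> 2 * c"
proof -
  have "\<forall>\<^sub>F y in at z within \<Omega>. v y - \<phi> y \<le> v z - \<phi> z"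
    using assms(4) filter_leD[OF at_le[OF subset_UNIV]] by blast
  then have "mechanical_Hamiltonian V z (p + G z) - c \<le> 0"
    using assms(1-3) unfolding cell_problem_solution_def viscosity_subsolution_def by blast
  moreover have "V z = 0" using V_zero assms(2) closure_subset by blast
  ultimately show ?thesis by (simp add: mechanical_Hamiltonian_def)
qed

lemma cell_supersolution:
  assumes "cell p c v" "z \<in> closure \<Omega>" "C1_gradient \<phi> G"
    and "\<forall>\<^sub>F y in at z within closure \<Omega>. v y - \<phi> y \<ge> v z - \<phi> z"
  shows "(norm (p + G z))\<^sup>2 \<ge> 2 * c"
proof -
  have "mechanical_Hamiltonian V z (p + G z) - c \<ge> 0"
    using assms unfolding cell_problem_solution_def viscosity_supersolution_def by blast
  then show ?thesis using V_zero assms(2) by (simp add: mechanical_Hamiltonian_def)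
qed

text \<open>The zero test function touches the corrector at its minimum over
  \<open>closure \<Omega>\<close>. The minimum may lie on the boundary, a case covered by the
  state-constraint supersolution property.\<close>

lemma cell_constant_le:
  assumes "cell p c v" shows "c \<le> (norm p)\<^sup>2 / 2"
proof -
  obtain x where x: "x \<in> closure \<Omega>" "\<And>y. y \<in> closure \<Omega> \<Longrightarrow> v x \<le> v y"
    using periodic_attains_inf[OF cell_continuous[OF assms] cell_periodic[OF assms]] by blast
  have "C1_gradient (\<lambda>_. 0) (\<lambda>_. 0 :: real ^ 'n)"
    by (simp add: C1_gradient_def gderiv_def)
  moreover have "\<forall>\<^sub>F y in at x within closure \<Omega>. v y - 0 \<ge> v x - 0"
    using x(2) by (simp add: eventually_at_filter)
  ultimately have "(norm (p + 0))\<^sup>2 \<ge> 2 * c" by (rule cell_supersolution[OF assms x(1)])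
  then show ?thesis by simp
qed

text \<open>The admissible gradients \<open>r\<close> form a ball about \<open>- p\<close> of
  squared radius \<open>2 * c\<close>, which is empty for \<open>c < 0\<close> and a single point
  for \<open>c = 0\<close>; both cases are exploited below.\<close>

lemma cell_segment_bound:
  assumes "cell p c v" and "closed_segment a (a + q) \<subseteq> \<Omega>" and "q \<noteq> 0"
    and "\<And>r. (norm (p + r))\<^sup>2 \<le> 2 * c \<Longrightarrow> r \<bullet> q \<le> l"
  shows "v (a + q) \<le> v a + l"
proof (rule viscosity_subsolution_along_segment[OF open_Omega cell_continuous_Omega[OF assms(1)] _ assms(2,3)])
  have "viscosity_subsolution (\<lambda>y q. mechanical_Hamiltonian V y (p + q) - c) \<Omega> v"
    using assms(1) by (simp add: cell_problem_solution_def)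
  then show "viscosity_subsolution (\<lambda>z r. r \<bullet> q - l) \<Omega> v"
  proof (rule viscosity_subsolution_mono[OF _ open_Omega order_refl])
    fix z r assume "z \<in> \<Omega>" "mechanical_Hamiltonian V z (p + r) - c \<le> 0"
    moreover have "V z = 0" using V_zero \<open>z \<in> \<Omega>\<close> closure_subset by blast
    ultimately show "r \<bullet> q - l \<le> 0" using assms(4)[of r] by (simp add: mechanical_Hamiltonian_def)
  qed
qed

lemma cell_constant_nonneg:
  assumes "cell p c v" shows "c \<ge> 0"
proof (rule ccontr)
  assume "\<not> c \<ge> 0"
  define a :: "real ^ 'n" where "a = (\<chi> i. 1/2)"
  obtain r where r: "r > 0" "cball a r \<subseteq> \<Omega>"
    using open_contains_cball open_Omega Omega_nonempty unfolding a_def by blast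
  define q :: "real ^ 'n" where "q = r *\<^sub>R axis undefined 1"
  have "norm q = r" using r by (simp add: q_def norm_axis_1)
  then have q: "q \<noteq> 0" "a \<in> cball a r" "a + q \<in> cball a r" using r by (auto simp: dist_norm)
  have "closed_segment a (a + q) \<subseteq> \<Omega>"
    using closed_segment_subset[OF q(2,3) convex_cball] r(2) by blast
  \<comment> \<open>No gradient is admissible for \<open>c < 0\<close>, so any increment bound
    holds, even one that is 1 below the actual increment.\<close>
  moreover have "s \<bullet> q \<le> v (a + q) - v a - 1" if "(norm (p + s))\<^sup>2 \<le> 2 * c" for s
    using that \<open>\<not> c \<ge> 0\<close> zero_le_power2[of "norm (p + s)"] by linarith
  ultimately have "v (a + q) \<le> v a + (v (a + q) - v a - 1)"
    using q(1) by (intro cell_segment_bound[OF assms]) auto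
  then show False by simp
qed

text \<open>At level 0 the gradient of \<open>v\<close> can only be \<open>- p\<close>, so
  \<open>v x + p \<bullet> x\<close> is locally constant, hence constant on the connected \<Omega>.
  Between points differing by a lattice vector the periodic \<open>v\<close> drops out, which leaves
  \<open>p \<bullet> axis i 1 = 0\<close>.\<close>

lemma cell_constant_zero:
  assumes conn: "connected \<Omega>" and cell: "cell p 0 v"
  shows "p = 0"
proof -
  define f where "f x = v x + p \<bullet> x" for x
  have incr: "f b \<le> f a" if "closed_segment a b \<subseteq> \<Omega>" for a b
  proof (cases "b = a")
    case False
    have "v (a + (b - a)) \<le> v a + (- p \<bullet> (b - a))"
    proof (rule cell_segment_bound[OF cell])
      fix r assume "(norm (p + r))\<^sup>2 \<le> 2 * 0"
      then have "r + p = 0" by (simp add: add.commute)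
      then have "r = - p" by (simp only: eq_neg_iff_add_eq_0)
      then show "r \<bullet> (b - a) \<le> - p \<bullet> (b - a)" by simp
    qed (use that False in auto)
    then show ?thesis by (simp add: f_def inner_diff_right)
  qed simp
  have "f constant_on \<Omega>"
  proof (rule locally_constant_imp_constant[OF conn])
    fix a assume "a \<in> \<Omega>"
    then obtain r where r: "r > 0" "ball a r \<subseteq> \<Omega>" using openE[OF open_Omega] by metis
    have "f x = f a" if "x \<in> ball a r" for x
    proof -
      have "closed_segment a x \<subseteq> \<Omega>"
        using closed_segment_subset[of a "ball a r" x] that r by auto
      then show ?thesis using incr[of a x] incr[of x a] by (simp add: closed_segment_commute)
    qed
    moreover have "openin (top_of_set \<Omega>) (ball a r)"
      using r open_Omega by (simp add: openin_open_eq)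
    ultimately show "\<exists>T. openin (top_of_set \<Omega>) T \<and> a \<in> T \<and> (\<forall>x\<in>T. f x = f a)"
      using centre_in_ball[of a r] r(1) by blast
  qed
  then obtain k where k: "\<And>x. x \<in> \<Omega> \<Longrightarrow> f x = k" unfolding constant_on_def by blast
  define a :: "real ^ 'n" where "a = (\<chi> i. 1/2)"
  have "p $ i = 0" for i
  proof -
    have a: "a \<in> \<Omega>" "a + axis i 1 \<in> \<Omega>"
      using Omega_nonempty Omega_translate[OF Omega_nonempty axis_in_int_lattice] by (auto simp: a_def)
    then have "v (a + axis i 1) = v a"
      using cell_periodic[OF cell, unfolded lattice_periodic_on_def, rule_format, OF axis_in_int_lattice]
        a[THEN subsetD[OF closure_subset]] by simp
    then have "p \<bullet> axis i 1 = 0" using k[OF a(1)] k[OF a(2)] by (simp add: f_def inner_add_right)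
    then show ?thesis by (simp add: inner_axis)
  qed
  then show ?thesis by (simp add: vec_eq_iff)
qed

text \<open>Where the potential is zero the Hamiltonian is 2-homogeneous; a positive factor
  preserves the direction of touching, with the test function divided by \<open>t\<close>.\<close>

lemma cell_scale:
  assumes cell: "cell p c v" and "t > 0"
  shows "cell (t *\<^sub>R p) (t\<^sup>2 * c) (\<lambda>y. t * v y)"
proof -
  have C1: "C1_gradient (\<lambda>y. \<phi> y / t) (\<lambda>y. G y /\<^sub>R t)" if "C1_gradient \<phi> G" for \<phi> and G :: "real ^ 'n \<Rightarrow> real ^ 'n"
    using that \<open>t > 0\<close> unfolding C1_gradient_def gderiv_def
    by (auto intro!: derivative_eq_intros continuous_intros simp: divide_inverse)
  have diff: "t * a - b = t * (a - b / t)" for a b using \<open>t > 0\<close> by (simp add: right_diff_distrib)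
  have norm_scale: "(norm (t *\<^sub>R p + g))\<^sup>2 = t\<^sup>2 * (norm (p + g /\<^sub>R t))\<^sup>2" for g
  proof -
    have "t *\<^sub>R p + g = t *\<^sub>R (p + g /\<^sub>R t)" using \<open>t > 0\<close> by (simp add: scaleR_add_right)
    then show ?thesis by (simp add: power_mult_distrib)
  qed
  have "viscosity_subsolution (\<lambda>y q. mechanical_Hamiltonian V y (t *\<^sub>R p + q) - t\<^sup>2 * c) \<Omega> (\<lambda>y. t * v y)"
    unfolding viscosity_subsolution_def
  proof (intro allI ballI impI)
    fix \<phi> G z
    assume z: "z \<in> \<Omega>" and \<phi>: "C1_gradient \<phi> G"
      and "\<forall>\<^sub>F z' in at z within \<Omega>. t * v z' - \<phi> z' \<le> t * v z - \<phi> z"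
    then have "\<forall>\<^sub>F z' in at z. v z' - \<phi> z' / t \<le> v z - \<phi> z / t"
      using \<open>t > 0\<close> unfolding diff at_within_open[OF z open_Omega] by simp
    then have "(norm (p + G z /\<^sub>R t))\<^sup>2 \<le> 2 * c" by (rule cell_subsolution[OF cell z C1[OF \<phi>]])
    then have "t\<^sup>2 * (norm (p + G z /\<^sub>R t))\<^sup>2 \<le> t\<^sup>2 * (2 * c)" by (intro mult_left_mono) auto
    moreover have "V z = 0" using V_zero z closure_subset by blast
    ultimately show "mechanical_Hamiltonian V z (t *\<^sub>R p + G z) - t\<^sup>2 * c \<le> 0"
      by (simp add: mechanical_Hamiltonian_def norm_scale)
  qed
  moreover have "viscosity_supersolution (\<lambda>y q. mechanical_Hamiltonian V y (t *\<^sub>R p + q) - t\<^sup>2 * c)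
      (closure \<Omega>) (\<lambda>y. t * v y)"
    unfolding viscosity_supersolution_def
  proof (intro allI ballI impI)
    fix \<phi> G z
    assume z: "z \<in> closure \<Omega>" and \<phi>: "C1_gradient \<phi> G"
      and "\<forall>\<^sub>F z' in at z within closure \<Omega>. t * v z' - \<phi> z' \<ge> t * v z - \<phi> z"
    then have "\<forall>\<^sub>F z' in at z within closure \<Omega>. v z' - \<phi> z' / t \<ge> v z - \<phi> z / t"
      using \<open>t > 0\<close> unfolding diff by simp
    then have "(norm (p + G z /\<^sub>R t))\<^sup>2 \<ge> 2 * c" by (rule cell_supersolution[OF cell z C1[OF \<phi>]])
    then have "t\<^sup>2 * (norm (p + G z /\<^sub>R t))\<^sup>2 \<ge> t\<^sup>2 * (2 * c)" by (intro mult_left_mono) auto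
    then show "mechanical_Hamiltonian V z (t *\<^sub>R p + G z) - t\<^sup>2 * c \<ge> 0"
      using V_zero[OF z] by (simp add: mechanical_Hamiltonian_def norm_scale)
  qed
  moreover have "continuous_on (closure \<Omega>) (\<lambda>y. t * v y)"
    using cell_continuous[OF cell] by (intro continuous_intros)
  moreover have "lattice_periodic_on (closure \<Omega>) (\<lambda>y. t * v y)"
    using cell_periodic[OF cell] by (auto simp: lattice_periodic_on_def)
  ultimately show ?thesis by (simp add: cell_problem_solution_def)
qed

text \<open>Comparison of the supersolution \<open>v\<close> with the sum of the subsolutions \<open>v1\<close> and \<open>v2\<close> by
  doubling of variables. As in Soner's argument for state constraints, the shift by \<open>h e\<close> in the
  penalty moves the points at which the subsolutions are tested into the open set \<open>\<Omega>\<close>.\<close>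

lemma cell_constant_subadditive:
  assumes C1: "C1_boundary D"
    and cell1: "cell p1 c1 v1" and cell2: "cell p2 c2 v2" and cell: "cell (p1 + p2) c v"
  shows "sqrt (2 * c) \<le> sqrt (2 * c1) + sqrt (2 * c2)"
proof (rule field_le_epsilon)
  fix \<epsilon> :: real assume "\<epsilon> > 0"
  define f where "f x = v x - v1 x - v2 x" for x
  have "continuous_on (closure \<Omega>) f" unfolding f_def
    by (intro continuous_intros cell_continuous[OF cell] cell_continuous[OF cell1] cell_continuous[OF cell2])
  moreover have "lattice_periodic_on (closure \<Omega>) f"
    using cell_periodic[OF cell] cell_periodic[OF cell1] cell_periodic[OF cell2]
    by (auto simp: lattice_periodic_on_def f_def)
  ultimately obtain x0 where x0: "x0 \<in> closure \<Omega>" and fmin: "\<And>y. y \<in> closure \<Omega> \<Longrightarrow> f x0 \<le> f y"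
    using periodic_attains_inf by blast
  obtain e \<theta> \<rho> where \<theta>: "\<theta> > 0" and \<rho>: "\<rho> > 0"
    and cone: "\<And>x h d. x \<in> closure \<Omega> \<Longrightarrow> dist x x0 < \<rho> \<Longrightarrow> 0 < h \<Longrightarrow> h < \<rho> \<Longrightarrow> norm d \<le> \<theta> \<Longrightarrow>
          x + h *\<^sub>R (e + d) \<in> \<Omega>"
    by (rule interior_cone[OF C1 x0]) (rule that)
  \<comment> \<open>The three bounds serve the final error \<open>2 * \<sigma>\<close>, the aperture
    of the cone and the localization of \<open>x\<close> near \<open>x0\<close>.\<close>
  define \<sigma> where "\<sigma> = min (\<epsilon> / 2) (min \<theta> (\<rho> / 4))"
  have \<sigma>: "\<sigma> > 0" "2 * \<sigma> \<le> \<epsilon>" "\<sigma> \<le> \<theta>" "\<sigma> \<le> \<rho> / 4" using \<open>\<epsilon> > 0\<close> \<theta> \<rho> by (auto simp: \<sigma>_def)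
  define K where "K = closure \<Omega> \<inter> cball x0 (\<rho> / 2)"
  have "compact K" unfolding K_def by (intro closed_Int_compact) auto
  have KO: "K \<subseteq> closure \<Omega>" by (auto simp: K_def)
  have moduli: "\<exists>B \<delta>. B \<ge> 0 \<and> \<delta> > 0 \<and> (\<forall>x\<in>K. \<bar>g x\<bar> \<le> B) \<and>
      (\<forall>x\<in>K. \<forall>y\<in>K. dist x y < \<delta> \<longrightarrow> \<bar>g x - g y\<bar> < \<sigma>\<^sup>2 / 4)" if "continuous_on (closure \<Omega>) g" for g :: "real ^ 'n \<Rightarrow> real"
  proof -
    have cg: "continuous_on K g" using that KO continuous_on_subset by blast
    from compact_imp_bounded[OF compact_continuous_image[OF cg \<open>compact K\<close>]]
    obtain B where "\<forall>x\<in>K. \<bar>g x\<bar> \<le> B" by (auto simp: bounded_iff)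
    then have B: "\<forall>x\<in>K. \<bar>g x\<bar> \<le> max B 0" by (auto simp: le_max_iff_disj)
    have "uniformly_continuous_on K g" by (rule compact_uniformly_continuous[OF cg \<open>compact K\<close>])
    moreover have "\<sigma>\<^sup>2 / 4 > 0" using \<sigma> by simp
    ultimately obtain \<delta> where "\<delta> > 0" "\<forall>x\<in>K. \<forall>y\<in>K. dist y x < \<delta> \<longrightarrow> dist (g y) (g x) < \<sigma>\<^sup>2 / 4"
      unfolding uniformly_continuous_on_def by blast
    then show ?thesis using B by (intro exI[of _ "max B 0"] exI[of _ \<delta>]) (auto simp: dist_real_def)
  qed
  obtain B1 \<delta>1 where g1: "B1 \<ge> 0" "\<delta>1 > 0" "\<And>x. x \<in> K \<Longrightarrow> \<bar>v1 x\<bar> \<le> B1"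
    "\<And>x y. x \<in> K \<Longrightarrow> y \<in> K \<Longrightarrow> dist x y < \<delta>1 \<Longrightarrow> \<bar>v1 x - v1 y\<bar> < \<sigma>\<^sup>2 / 4"
    using moduli[OF cell_continuous[OF cell1]] by blast
  obtain B2 \<delta>2 where g2: "B2 \<ge> 0" "\<delta>2 > 0" "\<And>x. x \<in> K \<Longrightarrow> \<bar>v2 x\<bar> \<le> B2"
    "\<And>x y. x \<in> K \<Longrightarrow> y \<in> K \<Longrightarrow> dist x y < \<delta>2 \<Longrightarrow> \<bar>v2 x - v2 y\<bar> < \<sigma>\<^sup>2 / 4"
    using moduli[OF cell_continuous[OF cell2]] by blast
  \<comment> \<open>The penalties are controlled by four differences, two of \<open>v1\<close> and
    two of \<open>v2\<close>, each at most twice the sup bound. This crude bound on \<open>E\<close>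
    is independent of \<open>h\<close> and gives \<open>norm (e + E x y) \<le> b\<close>; for
    \<open>h\<close> small relative to \<open>1 / b\<close>, uniform continuity then improves it to
    \<sigma>.\<close>
  define B where "B = 4 * B1 + 4 * B2"
  have B: "B \<ge> 0" using g1(1) g2(1) by (simp add: B_def)
  define b where "b = B + 1 + norm e"
  have b: "b \<ge> 1" using B by (simp add: b_def)
  define h where "h = min (min (\<rho> / 5) (\<rho> / 5 / b)) (min (\<delta>1 / 2 / b) (\<delta>2 / 2 / b))"
  have "\<rho> / 5 / b > 0" "\<delta>1 / 2 / b > 0" "\<delta>2 / 2 / b > 0"
    using \<rho> b g1(2) g2(2) by (intro divide_pos_pos; simp)+
  then have h0: "h > 0" using \<rho> unfolding h_def by linarith
  have "h \<le> \<rho> / 5 / b" "h \<le> \<delta>1 / 2 / b" "h \<le> \<delta>2 / 2 / b" and h1: "h \<le> \<rho> / 5"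
    unfolding h_def by linarith+
  then have "h * b \<le> \<rho> / 5" "h * b \<le> \<delta>1 / 2" "h * b \<le> \<delta>2 / 2"
    using b by (simp_all only: pos_le_divide_eq[of b] less_le_trans[OF zero_less_one])
  note h = h1 this
  \<comment> \<open>The deviation of \<open>y\<close> from \<open>x + h *\<^sub>R e\<close> in units
    of \<open>h\<close>; it plays the role of the perturbation \<open>d\<close> in the cone.\<close>
  define E where "E x y = (1 / h) *\<^sub>R (y - x) - e" for x y :: "real ^ 'n"
  have yE: "x + h *\<^sub>R (e + E x y) = y" for x y using h0 by (simp add: E_def)
  define \<Phi> where "\<Phi> z = v (fst z) - v1 (fst (snd z)) - v2 (snd (snd z))
      + (norm (E (fst z) (fst (snd z))))\<^sup>2 + (norm (E (fst z) (snd (snd z))))\<^sup>2 + (norm (fst z - x0))\<^sup>2" for z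
  have "compact (K \<times> K \<times> K)" using \<open>compact K\<close> by (intro compact_Times)
  moreover have "continuous_on (K \<times> K \<times> K) \<Phi>"
    unfolding \<Phi>_def E_def
    by (intro continuous_intros continuous_on_compose2[OF cell_continuous[OF cell]]
        continuous_on_compose2[OF cell_continuous[OF cell1]] continuous_on_compose2[OF cell_continuous[OF cell2]])
      (auto simp: K_def)
  moreover have x0K: "x0 \<in> K" using x0 \<rho> by (simp add: K_def)
  then have "K \<times> K \<times> K \<noteq> {}" by auto
  ultimately obtain z where z: "z \<in> K \<times> K \<times> K" "\<And>z'. z' \<in> K \<times> K \<times> K \<Longrightarrow> \<Phi> z \<le> \<Phi> z'"
    using continuous_attains_inf[of "K \<times> K \<times> K" \<Phi>] by blast
  obtain x y1 y2 where zxy: "z = (x, y1, y2)" by (metis prod_cases3)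
  have K3: "x \<in> K" "y1 \<in> K" "y2 \<in> K" using z(1) by (auto simp: zxy)
  have min: "v x - v1 y1 - v2 y2 + (norm (E x y1))\<^sup>2 + (norm (E x y2))\<^sup>2 + (norm (x - x0))\<^sup>2
      \<le> v x' - v1 y1' - v2 y2' + (norm (E x' y1'))\<^sup>2 + (norm (E x' y2'))\<^sup>2 + (norm (x' - x0))\<^sup>2"
    if "x' \<in> K" "y1' \<in> K" "y2' \<in> K" for x' y1' y2'
    using z(2)[of "(x', y1', y2')"] that by (simp add: zxy \<Phi>_def)
  define xe where "xe = x0 + h *\<^sub>R e"
  have "h * norm e \<le> h * b" using h0 B by (intro mult_left_mono) (auto simp: b_def)
  then have dxe: "dist x0 xe \<le> h * b" using h0 by (simp add: xe_def dist_norm)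
  have "xe \<in> \<Omega>" using cone[OF x0, of h 0] \<rho> h0 h \<theta> by (simp add: xe_def)
  then have xeK: "xe \<in> K" using dxe h \<rho> closure_subset by (auto simp: K_def)
  have Exe: "E x0 xe = 0" using h0 by (simp add: E_def xe_def)
  have fx: "v x0 - v1 x0 - v2 x0 \<le> v x - v1 x - v2 x" using fmin[of x] K3 by (simp add: f_def K_def)
  \<comment> \<open>The competitor \<open>(x0, xe, xe)\<close> has zero penalty, and minimality of
    \<open>f\<close> at \<open>x0\<close> eliminates the values of \<open>v\<close>.\<close>
  have total: "(norm (E x y1))\<^sup>2 + (norm (E x y2))\<^sup>2 + (norm (x - x0))\<^sup>2
      \<le> (v1 y1 - v1 x) + (v2 y2 - v2 x) + (v1 x0 - v1 xe) + (v2 x0 - v2 xe)"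
    using min[OF x0K xeK xeK] fx by (simp add: Exe)
  have "v1 y - v1 y' \<le> 2 * B1" "v2 y - v2 y' \<le> 2 * B2" if "y \<in> K" "y' \<in> K" for y y'
    using g1(3)[OF that(1)] g1(3)[OF that(2)] g2(3)[OF that(1)] g2(3)[OF that(2)] by linarith+
  note this[OF K3(2,1)] this[OF K3(3,1)] this[OF x0K xeK]
  then have "(v1 y1 - v1 x) + (v2 y2 - v2 x) + (v1 x0 - v1 xe) + (v2 x0 - v2 xe) \<le> B"
    unfolding B_def by linarith
  then have rough: "(norm (E x y1))\<^sup>2 \<le> B" "(norm (E x y2))\<^sup>2 \<le> B"
    using total zero_le_power2[of "norm (E x y1)"] zero_le_power2[of "norm (E x y2)"]
      zero_le_power2[of "norm (x - x0)"] by linarith+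
  have near: "dist x y \<le> h * b" if "(norm (E x y))\<^sup>2 \<le> B" for y
  proof -
    have "B \<le> (B + 1) * (B + 1)" using B by (simp add: distrib_left)
    then have "(norm (E x y))\<^sup>2 \<le> (B + 1)\<^sup>2" using that unfolding power2_eq_square by linarith
    then have "norm (E x y) \<le> B + 1" by (rule power2_le_imp_le) (use B in simp)
    then have "norm (e + E x y) \<le> b" using norm_triangle_ineq[of e "E x y"] unfolding b_def by linarith
    then have "h * norm (e + E x y) \<le> h * b" using h0 by (intro mult_left_mono) auto
    moreover have "dist x y = h * norm (e + E x y)"
    proof -
      have "dist x y = norm (y - x)" by (simp add: dist_norm norm_minus_commute)
      also have "y - x = h *\<^sub>R (e + E x y)" using h0 by (simp add: E_def)
      also have "norm \<dots> = h * norm (e + E x y)" using h0 by simp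
      finally show ?thesis .
    qed
    ultimately show ?thesis by simp
  qed
  have d12: "dist x y1 \<le> h * b" "dist x y2 \<le> h * b" using near rough by auto
  have osc: "v1 y - v1 y' < \<sigma>\<^sup>2 / 4" "v2 y - v2 y' < \<sigma>\<^sup>2 / 4"
    if "y \<in> K" "y' \<in> K" "dist y y' \<le> h * b" for y y'
    using g1(4)[OF that(1,2)] g2(4)[OF that(1,2)] that(3) h(3,4) g1(2) g2(2) by linarith+
  note osc(1)[OF K3(2,1)] osc(2)[OF K3(3,1)] osc[OF x0K xeK dxe]
  then have "(v1 y1 - v1 x) + (v2 y2 - v2 x) + (v1 x0 - v1 xe) + (v2 x0 - v2 xe) < \<sigma>\<^sup>2"
    using d12 by (simp add: dist_commute)
  then have fine: "(norm (E x y1))\<^sup>2 < \<sigma>\<^sup>2" "(norm (E x y2))\<^sup>2 < \<sigma>\<^sup>2" "(norm (x - x0))\<^sup>2 < \<sigma>\<^sup>2"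
    using total zero_le_power2[of "norm (E x y1)"] zero_le_power2[of "norm (E x y2)"]
      zero_le_power2[of "norm (x - x0)"] by linarith+
  then have E: "norm (E x y1) < \<sigma>" "norm (E x y2) < \<sigma>" "norm (x - x0) < \<sigma>"
    using \<sigma>(1) by (auto intro: power2_less_imp_less)
  have xO: "x \<in> closure \<Omega>" "dist x x0 < \<rho> / 4" using K3 E \<sigma> by (auto simp: K_def dist_norm)
  \<comment> \<open>Here the shift acts: \<open>y = x + h *\<^sub>R (e + E x y)\<close> lies in the
    open set even if \<open>x\<close> is a boundary point.\<close>
  have yO: "y \<in> \<Omega> \<inter> ball x0 (\<rho> / 2)" if "norm (E x y) < \<sigma>" "dist x y \<le> h * b" for y
  proof
    show "y \<in> \<Omega>"
      using cone[of x h "E x y"] xO h0 h(1) \<rho> \<sigma> that by (simp add: yE)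
    show "y \<in> ball x0 (\<rho> / 2)"
      using dist_triangle[of x0 y x] that xO h \<rho> by (simp add: dist_commute)
  qed
  have ev: "\<forall>\<^sub>F y in at y'. y \<in> K" if "y' \<in> \<Omega> \<inter> ball x0 (\<rho> / 2)" for y'
  proof -
    have "open (\<Omega> \<inter> ball x0 (\<rho> / 2))" using open_Omega by auto
    then have "\<forall>\<^sub>F y in at y'. y \<in> \<Omega> \<inter> ball x0 (\<rho> / 2)" using that by (rule eventually_at_in_open')
    then show ?thesis by eventually_elim (use closure_subset in \<open>auto simp: K_def\<close>)
  qed
  have test: "C1_gradient (\<lambda>y. (norm (E x y))\<^sup>2) (\<lambda>y. (2 / h) *\<^sub>R E x y)"
    unfolding C1_gradient_def gderiv_def E_def power2_norm_eq_inner
    using h0 by (auto intro!: derivative_eq_intros continuous_intros ext simp: inner_commute)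
  have "(norm (p1 + (2 / h) *\<^sub>R E x y1))\<^sup>2 \<le> 2 * c1"
  proof (rule cell_subsolution[OF cell1 _ test])
    show "y1 \<in> \<Omega>" using yO E d12 by blast
    show "\<forall>\<^sub>F y in at y1. v1 y - (norm (E x y))\<^sup>2 \<le> v1 y1 - (norm (E x y1))\<^sup>2"
      using ev[OF yO[OF E(1) d12(1)]]
    proof eventually_elim
      case (elim y)
      then show ?case using min[OF K3(1) elim K3(3)] by simp
    qed
  qed
  then have n1: "norm (p1 + (2 / h) *\<^sub>R E x y1) \<le> sqrt (2 * c1)" by (rule real_le_rsqrt)
  have "(norm (p2 + (2 / h) *\<^sub>R E x y2))\<^sup>2 \<le> 2 * c2"
  proof (rule cell_subsolution[OF cell2 _ test])
    show "y2 \<in> \<Omega>" using yO E d12 by blast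
    show "\<forall>\<^sub>F y in at y2. v2 y - (norm (E x y))\<^sup>2 \<le> v2 y2 - (norm (E x y2))\<^sup>2"
      using ev[OF yO[OF E(2) d12(2)]]
    proof eventually_elim
      case (elim y)
      then show ?case using min[OF K3(1,2) elim] by simp
    qed
  qed
  then have n2: "norm (p2 + (2 / h) *\<^sub>R E x y2) \<le> sqrt (2 * c2)" by (rule real_le_rsqrt)
  \<comment> \<open>The penalties depend on \<open>y - x\<close>, so their gradients in
    \<open>x\<close> and in \<open>y\<close> are opposite. With the sign of \<open>\<phi>\<close>,
    \<open>p1 + p2 + G x\<close> is the sum of the vectors estimated in \<open>n1\<close> and
    \<open>n2\<close>, up to \<open>2 *\<^sub>R (x - x0)\<close>.\<close>
  define \<phi> where "\<phi> x' = - ((norm (E x' y1))\<^sup>2 + (norm (E x' y2))\<^sup>2 + (norm (x' - x0))\<^sup>2)" for x'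
  define G where "G x' = (2 / h) *\<^sub>R E x' y1 + (2 / h) *\<^sub>R E x' y2 - 2 *\<^sub>R (x' - x0)" for x'
  have dE: "((\<lambda>x. (norm (E x y))\<^sup>2) has_derivative (\<lambda>k. - (k \<bullet> (2 / h) *\<^sub>R E x y))) (at x)" for x y
    unfolding E_def power2_norm_eq_inner
    by (auto intro!: derivative_eq_intros ext simp: inner_commute)
  have d0: "((\<lambda>x. (norm (x - x0))\<^sup>2) has_derivative (\<lambda>k. k \<bullet> 2 *\<^sub>R (x - x0))) (at x)" for x
    unfolding power2_norm_eq_inner
    by (auto intro!: derivative_eq_intros ext simp: inner_commute)
  have C1\<phi>: "C1_gradient \<phi> G"
    unfolding C1_gradient_def gderiv_def
  proof
    show "\<forall>x. (\<phi> has_derivative (\<lambda>k. k \<bullet> G x)) (at x)"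
    proof
      fix x
      show "(\<phi> has_derivative (\<lambda>k. k \<bullet> G x)) (at x)"
        unfolding \<phi>_def G_def
        by (rule has_derivative_eq_rhs,
            rule has_derivative_minus[OF has_derivative_add[OF has_derivative_add[OF dE dE] d0]])
          (simp add: inner_add_right inner_diff_right fun_eq_iff)
    qed
    show "continuous_on UNIV G" unfolding G_def E_def by (intro continuous_intros)
  qed
  have "2 * c \<le> (norm (p1 + p2 + G x))\<^sup>2"
  proof (rule cell_supersolution[OF cell xO(1) C1\<phi>])
    have "\<forall>\<^sub>F x' in at x. x' \<in> ball x0 (\<rho> / 2)"
      using xO(2) \<rho> by (intro eventually_at_in_open') (auto simp: dist_commute)
    then show "\<forall>\<^sub>F x' in at x within closure \<Omega>. v x - \<phi> x \<le> v x' - \<phi> x'"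
      unfolding eventually_at_filter
    proof eventually_elim
      case (elim x')
      show ?case
      proof (intro impI)
        assume "x' \<noteq> x" "x' \<in> closure \<Omega>"
        then have "x' \<in> K" using elim by (auto simp: K_def)
        show "v x - \<phi> x \<le> v x' - \<phi> x'" using min[OF \<open>x' \<in> K\<close> K3(2,3)] unfolding \<phi>_def by linarith
      qed
    qed
  qed
  then have "sqrt (2 * c) \<le> norm (p1 + p2 + G x)" by (rule real_le_lsqrt[OF norm_ge_zero])
  also have "p1 + p2 + G x = (p1 + (2 / h) *\<^sub>R E x y1) + (p2 + (2 / h) *\<^sub>R E x y2) + (- 2) *\<^sub>R (x - x0)"
    by (simp add: G_def algebra_simps)
  also have "norm \<dots> \<le> norm (p1 + (2 / h) *\<^sub>R E x y1) + norm (p2 + (2 / h) *\<^sub>R E x y2) + norm ((- 2) *\<^sub>R (x - x0))"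
    by (intro order_trans[OF norm_triangle_ineq] add_mono norm_triangle_ineq order_refl)
  also have "\<dots> \<le> sqrt (2 * c1) + sqrt (2 * c2) + \<epsilon>"
    using n1 n2 E(3) \<sigma>(2) by (intro add_mono) simp_all
  finally show "sqrt (2 * c) \<le> sqrt (2 * c1) + sqrt (2 * c2) + \<epsilon>" .
qed

end

text \<open>Sublinearity of \<open>N\<close> gives midpoint convexity of \<open>H\<close>; the
  parallelogram identity turns the added quadratic into the midpoint strong convexity that the
  smooth transform requires.\<close>

lemma sublinear_quadratic_conjugate:
  fixes H :: "real ^ 'n \<Rightarrow> real"
  assumes nonneg: "\<And>p. H p \<ge> 0" and upper: "\<And>p. H p \<le> (norm p)\<^sup>2 / 2"
    and hom: "\<And>t p. t > 0 \<Longrightarrow> H (t *\<^sub>R p) = t\<^sup>2 * H p"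
    and subadd: "\<And>p q. sqrt (2 * H (p + q)) \<le> sqrt (2 * H p) + sqrt (2 * H q)"
    and definite: "\<And>p. H p = 0 \<Longrightarrow> p = 0"
    and "\<kappa> > 1"
  shows "\<exists>L P. C1_gradient L P \<and> (\<forall>q. H (P q) \<le> L q) \<and>
        (\<forall>p q. p \<bullet> q - H p \<le> \<kappa> * L q) \<and> (\<forall>t q. t > 0 \<longrightarrow> L (t *\<^sub>R q) = t\<^sup>2 * L q) \<and>
        (\<forall>q. (norm q)\<^sup>2 / 4 \<le> L q)"
proof -
  define N where "N p = sqrt (2 * H p)" for p
  have N_nonneg: "N p \<ge> 0" for p using nonneg by (simp add: N_def)
  have HN: "H p = (N p)\<^sup>2 / 2" for p using nonneg by (simp add: N_def)
  have N_le: "N p \<le> norm p" for p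
    using upper[of p] unfolding N_def by (intro real_le_lsqrt) auto
  have N_sub: "N (p + q) \<le> N p + N q" for p q using subadd by (simp add: N_def)
  have N_lip: "\<bar>N p - N q\<bar> \<le> 1 * norm (p - q)" for p q
    using N_sub[of q "p - q"] N_sub[of p "q - p"] N_le[of "p - q"] N_le[of "q - p"]
    by (simp add: norm_minus_commute abs_le_iff)
  have "1-lipschitz_on UNIV N"
    by (rule lipschitz_onI) (use N_lip in \<open>auto simp: dist_norm\<close>)
  then have contN: "continuous_on UNIV N" by (rule lipschitz_on_continuous_on)
  have contH: "continuous_on X H" for X
    using continuous_on_subset[OF contN subset_UNIV, of X] unfolding HN[abs_def]
    by (intro continuous_intros) simp_all
  have H0: "H 0 = 0" using nonneg[of 0] upper[of 0] by simp
  have N_scale: "N ((1/2) *\<^sub>R p) = N p / 2" for p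
  proof -
    have "2 * H ((1/2) *\<^sub>R p) = 2 * H p / 4" by (simp add: hom power_divide)
    then show ?thesis unfolding N_def by (simp only: real_sqrt_divide real_sqrt_four)
  qed
  have midH: "H ((1/2) *\<^sub>R (p + p')) \<le> (H p + H p') / 2" for p p'
  proof -
    have "N ((1/2) *\<^sub>R (p + p')) \<le> N p / 2 + N p' / 2"
      using N_sub[of "(1/2) *\<^sub>R p" "(1/2) *\<^sub>R p'"] by (simp add: N_scale scaleR_add_right)
    then have "(N ((1/2) *\<^sub>R (p + p')))\<^sup>2 \<le> (N p / 2 + N p' / 2)\<^sup>2"
      using N_nonneg by (intro power_mono) auto
    moreover have "0 \<le> (N p - N p')\<^sup>2" by simp
    ultimately show ?thesis unfolding HN by (simp add: power2_eq_square algebra_simps)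
  qed
  obtain c where c: "c > 0" "\<And>p. c * (norm p)\<^sup>2 \<le> H p"
  proof -
    have "sphere (0 :: real ^ 'n) 1 \<noteq> {}" by simp
    then obtain s where s: "s \<in> sphere 0 1" "\<And>p. p \<in> sphere 0 1 \<Longrightarrow> H s \<le> H p"
      using continuous_attains_inf[OF compact_sphere _ contH, of 0 1] by blast
    have "H s > 0" using s(1) definite[of s] nonneg[of s] by fastforce
    moreover have "H s * (norm p)\<^sup>2 \<le> H p" for p
    proof (cases "p = 0")
      case False
      then have "H s \<le> H ((1 / norm p) *\<^sub>R p)" by (intro s(2)) simp
      then show ?thesis using False by (simp add: hom power_divide field_simps)
    qed (simp add: H0)
    ultimately show thesis by (rule that)
  qed
  \<comment> \<open>The bound 1 gives \<open>K p \<le> (norm p)\<^sup>2\<close>, hence quadratic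
    growth of \<open>L\<close>; the other bound gives
    \<open>K p \<le> \<kappa> * H p\<close>.\<close>
  define \<eta> where "\<eta> = min 1 (2 * (\<kappa> - 1) * c)"
  have "\<eta> \<le> 2 * (\<kappa> - 1) * c" unfolding \<eta>_def by (rule min.cobounded2)
  moreover have "\<eta> > 0" "\<eta> \<le> 1" using c \<open>\<kappa> > 1\<close> by (simp_all add: \<eta>_def)
  ultimately have \<eta>: "\<eta> > 0" "\<eta> \<le> 1" "\<eta> / 2 \<le> (\<kappa> - 1) * c" by linarith+
  define K where "K p = H p + \<eta> / 2 * (norm p)\<^sup>2" for p
  have K_le: "K p \<le> \<kappa> * H p" for p
  proof -
    have "\<eta> / 2 * (norm p)\<^sup>2 \<le> (\<kappa> - 1) * c * (norm p)\<^sup>2" using \<eta>(3) by (rule mult_right_mono) simp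
    also have "\<dots> \<le> (\<kappa> - 1) * H p"
      using mult_left_mono[OF c(2)[of p], of "\<kappa> - 1"] \<open>\<kappa> > 1\<close> by (simp add: mult.assoc)
    finally show ?thesis by (simp add: K_def algebra_simps)
  qed
  have K_norm: "K p \<le> (norm p)\<^sup>2" for p
    using upper[of p] mult_right_mono[OF \<eta>(2), of "(norm p)\<^sup>2"] by (simp add: K_def)
  have homK: "K (t *\<^sub>R p) = t\<^sup>2 * K p" if "t \<ge> 0" for t p
    using that hom[of t p] H0 by (cases "t = 0") (auto simp: K_def power_mult_distrib algebra_simps)
  obtain L P where LP: "C1_gradient L P" and fenchel: "\<And>p q. p \<bullet> q - K p \<le> L q"
    and KL: "\<And>q. K (P q) = L q" and homL: "\<And>t q. t > 0 \<Longrightarrow> L (t *\<^sub>R q) = t\<^sup>2 * L q"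
  proof (rule smooth_conjugate[of K \<eta>])
    show "continuous_on UNIV K" unfolding K_def by (intro continuous_intros contH)
    show "\<eta> / 2 * (norm p)\<^sup>2 \<le> K p" for p using nonneg by (simp add: K_def)
    show "K ((1/2) *\<^sub>R (p + p')) \<le> (K p + K p') / 2 - \<eta> / 8 * (norm (p - p'))\<^sup>2" for p p'
    proof -
      have "(norm ((1/2) *\<^sub>R (p + p')))\<^sup>2 = ((norm p)\<^sup>2 + (norm p')\<^sup>2) / 2 - (norm (p - p'))\<^sup>2 / 4"
        unfolding power2_norm_eq_inner by (simp add: inner_simps inner_commute field_simps)
      then have "K ((1/2) *\<^sub>R (p + p')) = H ((1/2) *\<^sub>R (p + p'))
          + \<eta> / 2 * (((norm p)\<^sup>2 + (norm p')\<^sup>2) / 2 - (norm (p - p'))\<^sup>2 / 4)"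
        unfolding K_def by (simp only:)
      then show ?thesis using midH[of p p'] by (simp add: K_def algebra_simps add_divide_distrib)
    qed
  qed (use \<eta> homK in auto)
  \<comment> \<open>Fenchel's inequality for \<open>K\<close> is used at
    \<open>p / \<kappa>\<close>, where homogeneity gives
    \<open>\<kappa> * K (p / \<kappa>) = K p / \<kappa> \<le> H p\<close>.\<close>
  have "p \<bullet> q - H p \<le> \<kappa> * L q" for p q
  proof -
    have "\<kappa> * (((1 / \<kappa>) *\<^sub>R p) \<bullet> q - K ((1 / \<kappa>) *\<^sub>R p)) \<le> \<kappa> * L q"
      using \<open>\<kappa> > 1\<close> by (intro mult_left_mono fenchel) auto
    moreover have "\<kappa> * (((1 / \<kappa>) *\<^sub>R p) \<bullet> q - K ((1 / \<kappa>) *\<^sub>R p)) = p \<bullet> q - K p / \<kappa>"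
      using \<open>\<kappa> > 1\<close> by (simp add: homK right_diff_distrib power_divide power2_eq_square)
    moreover have "K p / \<kappa> \<le> H p" using K_le[of p] \<open>\<kappa> > 1\<close> by (simp add: divide_le_eq mult.commute)
    ultimately show ?thesis by linarith
  qed
  moreover have "H (P q) \<le> L q" for q
  proof -
    have "0 \<le> \<eta> / 2 * (norm (P q))\<^sup>2" using \<eta>(1) by simp
    then show ?thesis using KL[of q] unfolding K_def by linarith
  qed
  \<comment> \<open>The vector \<open>q / 2\<close> maximizes
    \<open>p \<bullet> q - (norm p)\<^sup>2\<close>.\<close>
  moreover have "(norm q)\<^sup>2 / 4 \<le> L q" for q
    using fenchel[of "(1/2) *\<^sub>R q" q] K_norm[of "(1/2) *\<^sub>R q"]
    by (simp add: power_divide power2_norm_eq_inner)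
  ultimately show ?thesis using LP homL by blast
qed

text \<open>As \<open>Hbar\<close> is nonnegative, \<open>u\<close> cannot increase in time at a
  fixed point, whence \<open>u \<le> 0\<close>; the reverse inequality rests on the norm properties
  of \<open>sqrt (2 * Hbar p)\<close> obtained from correctors.\<close>

lemma (in perforated_cell) homogenized_Cauchy_zero:
  assumes "C1_boundary D" and "connected \<Omega>"
    and eff: "is_effective_Hamiltonian (mechanical_Hamiltonian V) \<Omega> Hbar"
    and sol: "state_constraint_Cauchy_solution (\<lambda>x p. Hbar p) UNIV (\<lambda>x. 0) u"
    and "t > 0"
  shows "u x t = 0"
proof -
  have ex: "\<exists>v. cell p (Hbar p) v" for p using eff by (simp add: is_effective_Hamiltonian_def)
  have uniq: "c = Hbar p" if "cell p c v" for p c v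
    using eff that unfolding is_effective_Hamiltonian_def by blast
  have nonneg: "Hbar p \<ge> 0" for p using ex cell_constant_nonneg by blast
  have hom: "Hbar (s *\<^sub>R p) = s\<^sup>2 * Hbar p" if "s > 0" for s p
    using ex[of p] cell_scale[OF _ that] uniq by metis
  have "u x t \<le> u x s" if "0 < s" "s < t" for s
  proof -
    have "u x t \<le> u x s + 0"
    proof (rule evolution_subsolution_increment[where u = u and H = Hbar and x = x and y = x and s = s and t = t])
      show "p \<bullet> (x - x) - (t - s) * Hbar p \<le> 0" for p using that nonneg by simp
    qed (use sol that in \<open>auto simp: state_constraint_Cauchy_solution_def\<close>)
    then show ?thesis by simp
  qed
  \<comment> \<open>Increments start at positive times only, so the initial value is reached by
    continuity.\<close>
  then have "\<forall>\<^sub>F s in at_right 0. u x t \<le> u x s"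
    using \<open>t > 0\<close> by (auto simp: eventually_at_right_field)
  moreover have "((\<lambda>s. u x s) \<longlongrightarrow> u x 0) (at_right 0)"
  proof -
    have "continuous_on (UNIV \<times> {0..}) (\<lambda>(x, t). u x t)"
      using sol by (simp add: state_constraint_Cauchy_solution_def)
    then have "continuous_on {0..} (\<lambda>s. (\<lambda>(x, t). u x t) (x, s))"
      by (rule continuous_on_compose2) (auto intro!: continuous_intros)
    then have "((\<lambda>s. u x s) \<longlongrightarrow> u x 0) (at 0 within {0..})" by (simp add: continuous_on)
    then show ?thesis by (rule tendsto_within_subset) auto
  qed
  ultimately have "u x t \<le> u x 0" by (intro tendsto_lowerbound) auto
  moreover have "u x 0 = 0" using sol by (simp add: state_constraint_Cauchy_solution_def)
  moreover have "u x t \<ge> 0"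
  proof (rule homogeneous_Cauchy_nonneg[OF sol hom _ \<open>t > 0\<close>])
    fix \<kappa> :: real assume \<kappa>: "\<kappa> > 1"
    show "\<exists>L P. C1_gradient L P \<and> (\<forall>q. Hbar (P q) \<le> L q) \<and>
        (\<forall>p q. p \<bullet> q - Hbar p \<le> \<kappa> * L q) \<and> (\<forall>t q. t > 0 \<longrightarrow> L (t *\<^sub>R q) = t\<^sup>2 * L q) \<and>
        (\<forall>q. (norm q)\<^sup>2 / 4 \<le> L q)"
    proof (rule sublinear_quadratic_conjugate[OF nonneg _ hom _ _ \<kappa>])
      show "Hbar p \<le> (norm p)\<^sup>2 / 2" for p using ex cell_constant_le by blast
      show "sqrt (2 * Hbar (p + q)) \<le> sqrt (2 * Hbar p) + sqrt (2 * Hbar q)" for p q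
        using ex[of p] ex[of q] ex[of "p + q"] cell_constant_subadditive[OF assms(1)] by blast
      show "p = 0" if "Hbar p = 0" for p
        using ex[of p] cell_constant_zero[OF assms(2), of p] that by auto
    qed
  qed
  ultimately show ?thesis by simp
qed

section \<open>The defect\<close>

lemma subsolution_at_defect:
  fixes w :: "real ^ 'n \<Rightarrow> real \<Rightarrow> real" and D :: "(real ^ 'n) set"
  assumes D: "open D" "0 \<in> D" "D \<subseteq> W" and V: "continuous_on UNIV V" and "\<epsilon> > 0"
    and sol: "state_constraint_Cauchy_solution
      (\<lambda>x p. mechanical_Hamiltonian V (x /\<^sub>R \<epsilon>) p) ((\<lambda>x. \<epsilon> *\<^sub>R x) ` W) (\<lambda>x. 0) w"
  shows "w 0 1 \<le> - V 0"
proof -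
  define X where "X = (\<lambda>x. \<epsilon> *\<^sub>R x) ` W"
  have cont: "continuous_on (closure X \<times> {0..}) (\<lambda>(x, t). w x t)"
    and sub: "viscosity_subsolution (evolution_operator (\<lambda>x p. mechanical_Hamiltonian V (x /\<^sub>R \<epsilon>) p))
      (X \<times> {0<..}) (\<lambda>(x, t). w x t)"
    and w0: "\<And>x. x \<in> closure X \<Longrightarrow> w x 0 = 0"
    using sol by (simp_all add: state_constraint_Cauchy_solution_def X_def)
  have "0 \<in> X" using D unfolding X_def by (intro image_eqI[of _ _ 0]) auto
  then have zero: "0 \<in> closure X" using closure_subset by blast
  have bound: "w 0 1 \<le> w 0 s - (1 - s) * (V 0 - \<delta>)" if s: "0 < s" "s < 1" and "\<delta> > 0" for s \<delta>
  proof -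
    have contV: "continuous_on UNIV (\<lambda>x. V (x /\<^sub>R \<epsilon>))"
      by (intro continuous_on_compose2[OF V] continuous_intros) auto
    \<comment> \<open>\<open>Y\<close> shrinks with \<epsilon> and \<delta>, but it always contains
      the origin and its size does not enter the bound, so \<delta> can tend to 0 at fixed
      \<epsilon>.\<close>
    define Y where "Y = (\<lambda>x. x /\<^sub>R \<epsilon>) -` D \<inter> {x. V 0 - \<delta> < V (x /\<^sub>R \<epsilon>)}"
    have "open Y" unfolding Y_def
      by (intro open_Int open_vimage D open_Collect_less contV continuous_intros)
    have "Y \<subseteq> X"
    proof
      fix x assume "x \<in> Y"
      then have "x /\<^sub>R \<epsilon> \<in> W" using D by (auto simp: Y_def)
      then show "x \<in> X" unfolding X_def using \<open>\<epsilon> > 0\<close> by (intro image_eqI[of _ _ "x /\<^sub>R \<epsilon>"]) auto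
    qed
    have "0 \<in> Y" using D \<open>\<delta> > 0\<close> by (simp add: Y_def)
    have "viscosity_subsolution (\<lambda>z p. p \<bullet> (0, 1 - s) - - (1 - s) * (V 0 - \<delta>)) (Y \<times> {0<..}) (\<lambda>(x, t). w x t)"
    proof (rule viscosity_subsolution_mono[OF sub])
      fix z P :: "(real ^ 'n) \<times> real"
      obtain x r p q where zP: "z = (x, r)" "P = (p, q)" by fastforce
      assume "z \<in> Y \<times> {0<..}"
        and "evolution_operator (\<lambda>x p. mechanical_Hamiltonian V (x /\<^sub>R \<epsilon>) p) z P \<le> 0"
      then have "V 0 - \<delta> < V (x /\<^sub>R \<epsilon>)" "q + ((norm p)\<^sup>2 / 2 + V (x /\<^sub>R \<epsilon>)) \<le> 0"
        by (simp_all add: Y_def zP evolution_operator_def mechanical_Hamiltonian_def)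
      then have "q \<le> - (V 0 - \<delta>)" using zero_le_power2[of "norm p"] by linarith
      then have "(1 - s) * q \<le> (1 - s) * - (V 0 - \<delta>)" using s by (intro mult_left_mono) auto
      then show "P \<bullet> (0, 1 - s) - - (1 - s) * (V 0 - \<delta>) \<le> 0" by (simp add: zP algebra_simps)
    qed (use \<open>open Y\<close> \<open>Y \<subseteq> X\<close> in \<open>auto intro: open_Times\<close>)
    moreover have "closed_segment (0, s) ((0, s) + (0, 1 - s)) \<subseteq> Y \<times> {0<..}"
    proof -
      have "closed_segment (0, s) (0, 1) \<subseteq> {0 :: real ^ 'n} \<times> {0<..}"
        by (rule closed_segment_subset) (use s in \<open>auto intro: convex_Times\<close>)
      then show ?thesis using \<open>0 \<in> Y\<close> by auto
    qed
    moreover have "continuous_on (Y \<times> {0<..}) (\<lambda>(x, t). w x t)"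
      using cont by (rule continuous_on_subset) (use \<open>Y \<subseteq> X\<close> closure_subset in fastforce)
    ultimately have "(\<lambda>(x, t). w x t) ((0, s) + (0, 1 - s)) \<le> (\<lambda>(x, t). w x t) (0, s) + - (1 - s) * (V 0 - \<delta>)"
      using \<open>open Y\<close> s by (intro viscosity_subsolution_along_segment[where S = "Y \<times> {0<..}"])
        (auto intro: open_Times simp: zero_prod_def)
    then show ?thesis by (simp add: left_diff_distrib)
  qed
  have lim_w: "((\<lambda>s. w 0 s) \<longlongrightarrow> w 0 0) (at_right 0)"
  proof -
    have "continuous_on {0..} (\<lambda>s. (\<lambda>(x, t). w x t) (0, s))"
      using cont by (rule continuous_on_compose2) (use zero in \<open>auto intro!: continuous_intros\<close>)
    then have "((\<lambda>s. w 0 s) \<longlongrightarrow> w 0 0) (at 0 within {0..})" by (simp add: continuous_on)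
    then show ?thesis by (rule tendsto_within_subset) auto
  qed
  have "w 0 1 \<le> - V 0 + \<delta>" if "\<delta> > 0" for \<delta>
  proof -
    have "((\<lambda>s. w 0 s - (1 - s) * (V 0 - \<delta>)) \<longlongrightarrow> w 0 0 - (1 - 0) * (V 0 - \<delta>)) (at_right 0)"
      by (intro tendsto_intros lim_w)
    moreover have "\<forall>\<^sub>F s in at_right 0. w 0 1 \<le> w 0 s - (1 - s) * (V 0 - \<delta>)"
      using bound that by (auto simp: eventually_at_right_field intro!: exI[of _ 1])
    ultimately have "w 0 1 \<le> w 0 0 - (1 - 0) * (V 0 - \<delta>)" by (rule tendsto_lowerbound) simp
    then show ?thesis using w0[OF zero] by simp
  qed
  then show ?thesis by (rule field_le_epsilon)
qed

theorem lemma6p6: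
  fixes D \<Omega> W :: "(real ^ 'n) set"
    and V :: "real ^ 'n \<Rightarrow> real"
    and Hbar :: "real ^ 'n \<Rightarrow> real"
    and w :: "real \<Rightarrow> real ^ 'n \<Rightarrow> real \<Rightarrow> real"
    and u :: "real ^ 'n \<Rightarrow> real \<Rightarrow> real"
    and g :: "real ^ 'n \<Rightarrow> real"
  assumes "CARD('n) \<ge> 2"
    and "open D" and "connected D" and "C1_boundary D" and "0 \<in> D"
    and "closure D \<subseteq> open_unit_cube"
    and "\<Omega> = perforated D int_lattice" and "connected \<Omega>"
    and "continuous_on UNIV V" and "lattice_periodic_on UNIV V"
    and "\<And>y. y \<in> closure \<Omega> \<Longrightarrow> V y = 0"
    and "\<And>y. y \<notin> closure \<Omega> \<Longrightarrow> V y > 0"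
    and "W = perforated D (int_lattice - {0})"
    and "g = (\<lambda>x. 0)"
    and "\<And>\<epsilon>. \<epsilon> > 0 \<Longrightarrow>
           state_constraint_Cauchy_solution
             (\<lambda>x p. mechanical_Hamiltonian V (x /\<^sub>R \<epsilon>) p) ((\<lambda>x. \<epsilon> *\<^sub>R x) ` W) g (w \<epsilon>)"
    and "is_effective_Hamiltonian (mechanical_Hamiltonian V) \<Omega> Hbar"
    and "state_constraint_Cauchy_solution (\<lambda>x p. Hbar p) UNIV g u"
  shows "Limsup (at_right 0) (\<lambda>\<epsilon>. ereal (w \<epsilon> 0 1)) \<le> ereal (- V 0) \<and>
         - V 0 < u 0 1 \<and> u 0 1 = 0"
proof -
  interpret perforated_cell D \<Omega> V
    using assms(2,6,7,11) by unfold_locales auto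
  have lattice0: "0 \<in> int_lattice" by (simp add: int_lattice_def)
  \<comment> \<open>Unit cubes around distinct lattice points are disjoint, so no remaining hole
    meets the one at the origin.\<close>
  have "D \<subseteq> W"
    unfolding assms(13)
  proof
    fix x assume "x \<in> D"
    then have x: "x - 0 \<in> open_unit_cube" using assms(6) closure_subset by auto
    show "x \<in> perforated D (int_lattice - {0})"
      unfolding mem_perforated
    proof (intro ballI notI)
      fix m assume m: "m \<in> int_lattice - {0}" "x - m \<in> closure D"
      then have "x - m \<in> open_unit_cube" using assms(6) by blast
      then have "m = 0" using open_unit_cube_lattice_unique[OF _ lattice0 _ x] m(1) by blast
      then show False using m(1) by blast
    qed
  qed
  then have "w \<epsilon> 0 1 \<le> - V 0" if "\<epsilon> > 0" for \<epsilon>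
    using subsolution_at_defect[OF assms(2,5) _ assms(9) that] assms(14) assms(15)[OF that] by simp
  then have "\<forall>\<^sub>F \<epsilon> in at_right 0. ereal (w \<epsilon> 0 1) \<le> ereal (- V 0)"
    by (auto simp: eventually_at_right_field intro!: exI[of _ 1])
  then have "Limsup (at_right 0) (\<lambda>\<epsilon>. ereal (w \<epsilon> 0 1)) \<le> ereal (- V 0)" by (rule Limsup_bounded)
  moreover have "0 \<notin> closure \<Omega>" using closure_Omega_avoids_holes[OF _ lattice0, of 0] assms(5) by auto
  then have "V 0 > 0" by (rule assms(12))
  moreover have "u 0 1 = 0"
    by (rule homogenized_Cauchy_zero[OF assms(4,8,16)]) (use assms(14,17) in auto)
  ultimately show ?thesis by simp
qed

end
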